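(* Let $G$ be a finite nilpotent group. Then the power graph $\mathcal{P}(G)$ is $C_4$-free if and only if, for some distinct primes $p,q,r$, one of the following holds: (1) $G\cong\mathbb{Z}_{pqr}$; (2) $G=P\times Q$, where $P$ is a $p$-group and $Q$ is a $q$-group such that $H_p(P)$ is cyclic and $\exp(Q)=q$; or (3) $G$ is a $p$-group.
   Context: The power graph $\mathcal{P}(G)$ of a finite group $G$ is the simple graph with vertex set $G$ in which two distinct elements $x,y$ are adjacent if and only if $x\in\langle y\rangle$ or $y\in\langle x\rangle$. A graph is $C_4$-free if it has no induced subgraph isomorphic to the cycle $C_4$ of length four. $\exp(G)$ denotes the exponent of $G$. For a group $G$ and a prime $p$, the Hughes subgroup $H_p(G)$ is the subgroup of $G$ generated by all elements of $G$ whose orders are different from $p$. *)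

theory Defs
  imports
    "HOL-Algebra.Elementary_Groups"
    "HOL-Algebra.Multiplicative_Group"
    "HOL-Computational_Algebra.Primes"
    "Graph_Theory.Pair_Digraph"
    "Graph_Theory.Digraph_Component"
    "Graph_Theory.Digraph_Isomorphism"
begin

text \<open>
  A simple graph is represented as a loop-free symmetric digraph without parallel arcs: the
  undirected edge between \<open>x\<close> and \<open>y\<close> becomes the two arcs \<open>(x, y)\<close> and \<open>(y, x)\<close>. For such
  digraphs induced subgraphs and isomorphisms are those of the underlying simple graphs.
\<close>

definition power_graph :: "('a, 'b) monoid_scheme \<Rightarrow> 'a pair_pre_digraph" where
  "power_graph G =
     \<lparr> pverts = carrier G,
       parcs = {(x, y). x \<in> carrier G \<and> y \<in> carrier G \<and> x \<noteq> y \<and>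
                        (x \<in> generate G {y} \<or> y \<in> generate G {x})} \<rparr>"

definition cycle4 :: "nat pair_pre_digraph" where
  "cycle4 =
     \<lparr> pverts = {0..<4},
       parcs = {(i, j). i < 4 \<and> j < 4 \<and> (j = (i + 1) mod 4 \<or> i = (j + 1) mod 4)} \<rparr>"

definition C4_free :: "'a pair_pre_digraph \<Rightarrow> bool" where
  "C4_free \<Gamma> \<longleftrightarrow>
     \<not> (\<exists>H. induced_subgraph H (with_proj \<Gamma>) \<and> digraph_iso H (with_proj cycle4))"

primrec lower_central_series :: "('a, 'b) monoid_scheme \<Rightarrow> nat \<Rightarrow> 'a set" where
  "lower_central_series G 0 = carrier G"
| "lower_central_series G (Suc n) =
     generate G {x \<otimes>\<^bsub>G\<^esub> y \<otimes>\<^bsub>G\<^esub> inv\<^bsub>G\<^esub> x \<otimes>\<^bsub>G\<^esub> inv\<^bsub>G\<^esub> y | x y.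
                   x \<in> carrier G \<and> y \<in> lower_central_series G n}"

definition nilpotent_group :: "('a, 'b) monoid_scheme \<Rightarrow> bool" where
  "nilpotent_group G \<longleftrightarrow> group G \<and> (\<exists>n. lower_central_series G n = {\<one>\<^bsub>G\<^esub>})"

text \<open>With this definition the trivial group is a \<open>p\<close>-group for every prime \<open>p\<close>.\<close>

definition p_group :: "nat \<Rightarrow> ('a, 'b) monoid_scheme \<Rightarrow> bool" where
  "p_group p G \<longleftrightarrow> group G \<and> (\<forall>x \<in> carrier G. \<exists>n. group.ord G x = p ^ n)"

text \<open>Meaningful only for groups of finite exponent, in particular for finite groups.\<close>

definition group_exponent :: "('a, 'b) monoid_scheme \<Rightarrow> nat" where
  "group_exponent G = (LEAST n. 0 < n \<and> (\<forall>x \<in> carrier G. x [^]\<^bsub>G\<^esub> n = \<one>\<^bsub>G\<^esub>))"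

definition hughes_subgroup :: "nat \<Rightarrow> ('a, 'b) monoid_scheme \<Rightarrow> ('a, 'b) monoid_scheme" where
  "hughes_subgroup p G = subgroup_generated G {x \<in> carrier G. group.ord G x \<noteq> p}"

definition internal_direct_product ::
    "('a, 'b) monoid_scheme \<Rightarrow> 'a set \<Rightarrow> 'a set \<Rightarrow> bool" where
  "internal_direct_product G P Q \<longleftrightarrow>
     P \<lhd> G \<and> Q \<lhd> G \<and> P \<inter> Q = {\<one>\<^bsub>G\<^esub>} \<and> P <#>\<^bsub>G\<^esub> Q = carrier G"

end

theory Submission
  imports Defs "HOL-Algebra.Sylow" "HOL-Computational_Algebra.Squarefree"
begin

text \<open>
  The power graph contains an induced \<open>C\<^sub>4\<close> iff some \<open>\<langle>b\<rangle> \<inter> \<langle>d\<rangle>\<close>, with \<open>b\<close> and \<open>d\<close>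
  non-adjacent, contains two non-adjacent elements. Since elements of a cyclic group are adjacent
  iff one of their orders divides the other, \<open>C\<^sub>4\<close>-freeness says that the cyclic subgroups
  containing two given elements of distinct prime orders form a chain.

  In a finite nilpotent group elements of coprime orders commute, so their products generate cyclic
  groups. With three primes the chain condition puts every element of prime power order into one
  cyclic group of order \<open>p q r\<close>. With two primes it excludes elements of order \<open>p\<^sup>2\<close> or elements of
  order \<open>q\<^sup>2\<close>, and it makes any two cyclic subgroups of the remaining factor \<open>P\<close> with nontrivial
  intersection comparable. Comparing \<open>\<langle>x\<rangle>\<close> with \<open>\<langle>x z\<rangle>\<close> for a central \<open>z\<close> of order \<open>p\<close> shows that
  every \<open>\<langle>x\<rangle>\<close> with \<open>x\<close> of order greater than \<open>p\<close> contains \<open>z\<close>. So these subgroups form a chain, and the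
  Hughes subgroup of \<open>P\<close> is cyclic.
\<close>

section \<open>Induced four-cycles\<close>

text \<open>A digraph isomorphism has separate maps on vertices and on arcs. Here tails and heads
  are \<open>fst\<close> and \<open>snd\<close> on both sides, so the vertex map determines the arc
  map and carries adjacency both ways. The preimages of 0, 1, 2, 3 then form the cycle.\<close>

lemma not_C4_freeE:
  assumes "\<not> C4_free \<Gamma>"
  obtains a b c d where "distinct [a, b, c, d]" "{a, b, c, d} \<subseteq> pverts \<Gamma>"
    "(a, b) \<in> parcs \<Gamma>" "(b, c) \<in> parcs \<Gamma>" "(c, d) \<in> parcs \<Gamma>" "(d, a) \<in> parcs \<Gamma>"
    "(a, c) \<notin> parcs \<Gamma>" "(b, d) \<notin> parcs \<Gamma>"
proof -
  obtain H f where ind: "induced_subgraph H (with_proj \<Gamma>)"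
    and f: "pre_digraph.digraph_isomorphism H f" and eq: "with_proj cycle4 = app_iso f H"
    using assms unfolding C4_free_def digraph_iso_def by blast
  define g where "g = iso_verts f"
  have HG: "verts H \<subseteq> pverts \<Gamma>" "tail H = fst" "head H = snd"
    and arcsH: "arcs H = {e \<in> parcs \<Gamma>. fst e \<in> verts H \<and> snd e \<in> verts H}"
    using ind by (auto simp: induced_subgraph_def subgraph_def compatible_def)
  have iso: "inj_on g (verts H)"
      "\<And>e. e \<in> arcs H \<Longrightarrow> g (fst e) = iso_tail f (iso_arcs f e)"
      "\<And>e. e \<in> arcs H \<Longrightarrow> g (snd e) = iso_head f (iso_arcs f e)"
    using f HG by (auto simp: pre_digraph.digraph_isomorphism_def g_def)
  have vimg: "g ` verts H = {0..<4}" and aimg: "iso_arcs f ` arcs H = parcs cycle4"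
    and pr: "iso_tail f = fst" "iso_head f = snd"
    using eq by (auto simp: app_iso_def with_proj_def cycle4_def g_def)
  have adj: "(u, v) \<in> parcs \<Gamma> \<longleftrightarrow> (g u, g v) \<in> parcs cycle4" if "u \<in> verts H" "v \<in> verts H" for u v
  proof
    assume "(u, v) \<in> parcs \<Gamma>"
    then have "(u, v) \<in> arcs H" using that arcsH by auto
    moreover from this have "iso_arcs f (u, v) = (g u, g v)"
      using iso(2,3)[of "(u, v)"] pr by (simp add: prod_eq_iff)
    ultimately show "(g u, g v) \<in> parcs cycle4" using aimg by (metis imageI)
  next
    assume "(g u, g v) \<in> parcs cycle4"
    then obtain e where e: "e \<in> arcs H" "iso_arcs f e = (g u, g v)" using aimg by (metis imageE)
    then have "g (fst e) = g u" "g (snd e) = g v" using iso(2,3)[of e] pr by simp_all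
    moreover have "fst e \<in> verts H" "snd e \<in> verts H" "e \<in> parcs \<Gamma>" using e arcsH by auto
    ultimately show "(u, v) \<in> parcs \<Gamma>" using iso(1) that by (metis inj_onD prod.collapse)
  qed
  have "\<forall>i\<in>{0..<4}. \<exists>v\<in>verts H. g v = i" using vimg by (metis imageE)
  then obtain h where h: "\<And>i. i < 4 \<Longrightarrow> h i \<in> verts H \<and> g (h i) = i"
    by (metis atLeastLessThan_iff zero_le)
  have hv: "h 0 \<in> verts H" "h 1 \<in> verts H" "h 2 \<in> verts H" "h 3 \<in> verts H"
    and gh: "g (h 0) = 0" "g (h 1) = 1" "g (h 2) = 2" "g (h 3) = 3"
    using h[of 0] h[of 1] h[of 2] h[of 3] by auto
  show ?thesis
  proof (rule that)
    show "distinct [h 0, h 1, h 2, h 3]"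
    proof -
      have "distinct (map g [h 0, h 1, h 2, h 3])" by (simp add: gh del: One_nat_def)
      then show ?thesis unfolding distinct_map by blast
    qed
    show "{h 0, h 1, h 2, h 3} \<subseteq> pverts \<Gamma>" using hv HG by auto
  qed (use hv gh in \<open>simp_all add: adj cycle4_def del: One_nat_def\<close>)
qed

text \<open>Symmetry and irreflexivity recover all sixteen adjacencies among the four vertices from
  the six given ones. This fixes the arcs of the induced subgraph, and numbering the vertices gives
  the isomorphism.\<close>

lemma not_C4_freeI:
  assumes wf: "pair_wf_digraph \<Gamma>" and sym: "sym (parcs \<Gamma>)" and irr: "irrefl (parcs \<Gamma>)"
    and dist: "distinct [a, b, c, d]"
    and arc: "(a, b) \<in> parcs \<Gamma>" "(b, c) \<in> parcs \<Gamma>" "(c, d) \<in> parcs \<Gamma>" "(d, a) \<in> parcs \<Gamma>"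
    and nonarc: "(a, c) \<notin> parcs \<Gamma>" "(b, d) \<notin> parcs \<Gamma>"
  shows "\<not> C4_free \<Gamma>"
proof -
  \<comment> \<open>The last branch is meant for \<open>d\<close>; only the values on
    \<open>V\<close> matter.\<close>
  define g :: "'a \<Rightarrow> nat" where "g = (\<lambda>v. if v = a then 0 else if v = b then 1 else if v = c then 2 else 3)"
  define V where "V = {a, b, c, d}"
  define H where "H = induce_subgraph (with_proj \<Gamma>) V"
  \<comment> \<open>The fields \<open>iso_head\<close> and \<open>iso_tail\<close> become the head
    and tail functions of the image, so they have to be the projections that
    \<open>with_proj\<close> uses.\<close>
  define f where "f = \<lparr> iso_verts = g, iso_arcs = map_prod g g, iso_head = snd, iso_tail = fst \<rparr>"
  interpret pair_wf_digraph \<Gamma> by (rule wf)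
  have V: "V \<subseteq> pverts \<Gamma>"
    using arc in_arcsD1 by (auto simp: V_def)
  have ind: "induced_subgraph H (with_proj \<Gamma>)"
    unfolding H_def using V by (intro induced_induce) simp
  then have wfH: "wf_digraph H" by (simp add: induced_subgraph_def subgraph_def)
  have gv: "g a = 0" "g b = 1" "g c = 2" "g d = 3"
    using dist by (auto simp: g_def)
  have "distinct (map g [a, b, c, d])" by (simp add: gv)
  then have inj: "inj_on g V" by (simp only: list.set distinct_map V_def)
  have parcs: "(b, a) \<in> parcs \<Gamma>" "(c, b) \<in> parcs \<Gamma>" "(d, c) \<in> parcs \<Gamma>" "(a, d) \<in> parcs \<Gamma>"
      "(c, a) \<notin> parcs \<Gamma>" "(d, b) \<notin> parcs \<Gamma>" "\<And>x. (x, x) \<notin> parcs \<Gamma>"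
    using symD[OF sym, of a b] symD[OF sym, of b c] symD[OF sym, of c d] symD[OF sym, of d a]
      symD[OF sym, of c a] symD[OF sym, of d b] irr arc nonarc by (auto simp: irrefl_def)
  have arcs: "arcs H = {(a, b), (a, d), (b, a), (b, c), (c, b), (c, d), (d, a), (d, c)}" (is "_ = ?A")
  proof
    show "?A \<subseteq> arcs H" using arc parcs by (simp add: H_def V_def)
    have "(u, v) \<in> ?A" if "(u, v) \<in> arcs H" for u v
    proof -
      have uv: "(u, v) \<in> parcs \<Gamma>" and u: "u = a \<or> u = b \<or> u = c \<or> u = d"
        and v: "v = a \<or> v = b \<or> v = c \<or> v = d"
        using that by (simp_all add: H_def V_def)
      show ?thesis
        using u
      proof (elim disjE)
        assume "u = a" then show ?thesis using v uv nonarc parcs by (elim disjE) simp_all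
      next
        assume "u = b" then show ?thesis using v uv nonarc parcs by (elim disjE) simp_all
      next
        assume "u = c" then show ?thesis using v uv nonarc parcs by (elim disjE) simp_all
      next
        assume "u = d" then show ?thesis using v uv nonarc parcs by (elim disjE) simp_all
      qed
    qed
    then show "arcs H \<subseteq> ?A" by (meson subrelI)
  qed
  have C: "parcs cycle4 = {(0, 1), (0, 3), (1, 0), (1, 2), (2, 1), (2, 3), (3, 0), (3, 2)}" (is "_ = ?C")
  proof
    show "?C \<subseteq> parcs cycle4" by (simp add: cycle4_def)
    have "(i, j) \<in> ?C" if "(i, j) \<in> parcs cycle4" for i j
    proof -
      have ij: "j = (i + 1) mod 4 \<or> i = (j + 1) mod 4" and "i < 4" "j < 4"
        using that by (simp_all add: cycle4_def)
      then have "i = 0 \<or> i = 1 \<or> i = 2 \<or> i = 3" "j = 0 \<or> j = 1 \<or> j = 2 \<or> j = 3" by arith+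
      then show ?thesis using ij by (elim disjE) simp_all
    qed
    then show "parcs cycle4 \<subseteq> ?C" by (meson subrelI)
  qed
  have "pre_digraph.digraph_isomorphism H f"
    unfolding pre_digraph.digraph_isomorphism_def
  proof (intro conjI ballI)
    have "inj_on (map_prod g g) (V \<times> V)" using inj by (intro map_prod_inj_on)
    moreover have "arcs H \<subseteq> V \<times> V" by (simp add: arcs V_def)
    ultimately have "inj_on (map_prod g g) (arcs H)" by (rule inj_on_subset)
    then show "inj_on (iso_arcs f) (arcs H)" by (simp add: f_def)
  qed (use wfH inj in \<open>auto simp: f_def H_def\<close>)
  moreover have "with_proj cycle4 = app_iso f H"
  proof -
    have "g ` V = {0..<4}" using gv by (auto simp: V_def)
    moreover have "map_prod g g ` arcs H = parcs cycle4" by (simp add: arcs gv C)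
    ultimately show ?thesis
      by (simp add: app_iso_def f_def with_proj_def H_def) (simp add: cycle4_def)
  qed
  ultimately show ?thesis
    using ind unfolding C4_free_def digraph_iso_def by blast
qed

context group
begin

lemma generate_singleton_trans:
  assumes "x \<in> generate G {y}" "y \<in> generate G {z}" "z \<in> carrier G"
  shows "x \<in> generate G {z}"
  using assms generate_subgroup_incl[of "{y}" "generate G {z}"] generate_is_subgroup[of "{z}"] by auto

text \<open>Membership in cyclic subgroups is transitive and opposite vertices of an induced
  four-cycle are non-adjacent, so memberships along the cycle must alternate in direction. Hence one
  opposite pair lies in the cyclic groups of both vertices of the other pair.\<close>

lemma C4_free_power_graph_iff:
  "C4_free (power_graph G) \<longleftrightarrow>
    (\<forall>a\<in>carrier G. \<forall>b\<in>carrier G. \<forall>c\<in>carrier G. \<forall>d\<in>carrier G.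
      a \<in> generate G {b} \<and> a \<in> generate G {d} \<and> c \<in> generate G {b} \<and> c \<in> generate G {d} \<longrightarrow>
      a \<in> generate G {c} \<or> c \<in> generate G {a} \<or> b \<in> generate G {d} \<or> d \<in> generate G {b})"
  (is "_ \<longleftrightarrow> ?R")
proof (rule iffI; rule ccontr)
  assume C: "C4_free (power_graph G)" and "\<not> ?R"
  then obtain a b c d where abcd: "a \<in> carrier G" "b \<in> carrier G" "c \<in> carrier G" "d \<in> carrier G"
    and "in": "a \<in> generate G {b}" "a \<in> generate G {d}" "c \<in> generate G {b}" "c \<in> generate G {d}"
    and notin: "a \<notin> generate G {c}" "c \<notin> generate G {a}" "b \<notin> generate G {d}" "d \<notin> generate G {b}"
    by blast
  \<comment> \<open>Any equality among the four would put a vertex into the cyclic group of its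
    opposite.\<close>
  have "distinct [a, b, c, d]"
    using "in" notin generate.incl[of _ "{_}" G, OF singletonI] by auto
  moreover have "pair_wf_digraph (power_graph G)"
    by unfold_locales (auto simp: power_graph_def)
  moreover have "sym (parcs (power_graph G))" "irrefl (parcs (power_graph G))"
    by (auto simp: power_graph_def sym_def irrefl_def)
  ultimately have "\<not> C4_free (power_graph G)"
    using abcd "in" notin by (intro not_C4_freeI[of _ a b c d]) (auto simp: power_graph_def)
  then show False using C by simp
next
  assume R: ?R and "\<not> C4_free (power_graph G)"
  then obtain a b c d where ab: "distinct [a, b, c, d]" "{a, b, c, d} \<subseteq> carrier G"
    "a \<in> generate G {b} \<or> b \<in> generate G {a}" "b \<in> generate G {c} \<or> c \<in> generate G {b}"
    "c \<in> generate G {d} \<or> d \<in> generate G {c}" "d \<in> generate G {a} \<or> a \<in> generate G {d}"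
    and n: "a \<notin> generate G {c}" "c \<notin> generate G {a}" "b \<notin> generate G {d}" "d \<notin> generate G {b}"
    by (elim not_C4_freeE) (auto simp: power_graph_def)
  have car: "a \<in> carrier G" "b \<in> carrier G" "c \<in> carrier G" "d \<in> carrier G" using ab by auto
  note tr = generate_singleton_trans
  show False
  proof (cases "a \<in> generate G {b}")
    case True
    \<comment> \<open>Were \<open>b\<close> in the cyclic group of \<open>c\<close>, then so would
      be \<open>a\<close>, which is opposite to \<open>c\<close>. The same argument is passed around
      the cycle.\<close>
    then have "c \<in> generate G {b}" using ab n tr[of a b c] car by blast
    then have "c \<in> generate G {d}" using ab n tr[of d c b] car by blast
    then have "a \<in> generate G {d}" using ab n tr[of c d a] car by blast
    then show False using R car True n \<open>c \<in> generate G {b}\<close> \<open>c \<in> generate G {d}\<close> by blast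
  next
    case False
    \<comment> \<open>Now \<open>b\<close> and \<open>d\<close> are the common members, and
      \<open>?R\<close> is applied with the two opposite pairs exchanged.\<close>
    then have "b \<in> generate G {a}" using ab by blast
    moreover from this have "b \<in> generate G {c}" using ab n tr[of c b a] car by blast
    moreover from this have "d \<in> generate G {c}" using ab n tr[of b c d] car by blast
    moreover from this have "d \<in> generate G {a}" using ab n tr[of a d c] car by blast
    ultimately show False using R car n by blast
  qed
qed

end

section \<open>Divisibility\<close>

lemma prime_power_factorE:
  fixes n :: nat
  assumes "n \<noteq> 1" "n \<noteq> 0"
  obtains s k m where "prime s" "k > 0" "n = s ^ k * m" "coprime (s ^ k) m" "m < n"
proof -
  obtain s where s: "prime s" "s dvd n" using assms prime_factor_nat by blast
  define k where "k = multiplicity s n"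
  obtain m where m: "n = s ^ k * m" "\<not> s dvd m"
    using multiplicity_decompose'[of n s] assms s by (metis k_def not_prime_unit mult.commute)
  have "k > 0" using s assms by (simp add: k_def prime_multiplicity_gt_zero_iff)
  moreover have "coprime (s ^ k) m" using s(1) m(2) by (simp add: prime_imp_coprime)
  moreover have "m < n"
  proof -
    have "1 < s ^ k" using s(1) \<open>k > 0\<close> one_less_power[of s k] prime_gt_1_nat by simp
    then show ?thesis using m(1) assms by simp
  qed
  ultimately show ?thesis using that s m by blast
qed

text \<open>Every prime has multiplicity at most 1 in a squarefree number, which therefore divides
  every number that all its prime divisors divide.\<close>

lemma squarefree_prime_not_dvd:
  fixes x y :: nat
  assumes "squarefree x" "\<not> x dvd y"
  obtains s where "prime s" "s dvd x" "\<not> s dvd y"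
proof -
  have "\<exists>s. prime s \<and> s dvd x \<and> \<not> s dvd y"
  proof (rule ccontr)
    assume none: "\<not> ?thesis"
    have "x dvd y"
    proof (cases "y = 0")
      case False
      have x0: "x \<noteq> 0" using assms(1) by (metis not_squarefree_0)
      have "multiplicity s x \<le> multiplicity s y" if s: "prime s" for s
      proof (cases "s dvd x")
        case True
        then have "multiplicity s y \<ge> 1"
          using none s False by (metis multiplicity_eq_zero_iff not_less_eq_eq le_zero_eq One_nat_def not_prime_unit)
        moreover have "multiplicity s x \<le> 1"
          using assms(1) s squarefree_factorial_semiring''[OF x0] by blast
        ultimately show ?thesis by simp
      qed (simp add: not_dvd_imp_multiplicity_0)
      then show ?thesis using x0 False by (intro multiplicity_le_imp_dvd)
    qed simp
    then show False using assms(2) by blast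
  qed
  then show ?thesis using that by blast
qed

text \<open>Divisors of a squarefree number behave like sets of primes. If both pairs were
  incomparable, there would be a prime in \<open>a\<close> only, one in \<open>c\<close> only, one
  in \<open>b\<close> only and one in \<open>d\<close> only. The first two divide both
  \<open>b\<close> and \<open>d\<close>, so the four are distinct, but only three primes are
  available.\<close>

lemma divisors_of_three_primes_comparable:
  fixes p q r :: nat
  assumes pr: "prime p" "prime q" "prime r" and ne: "p \<noteq> q" "p \<noteq> r" "q \<noteq> r"
    and dv: "b dvd p * q * r" "d dvd p * q * r" and a: "a dvd b" "a dvd d" and c: "c dvd b" "c dvd d"
  shows "a dvd c \<or> c dvd a \<or> b dvd d \<or> d dvd b"
proof (rule ccontr)
  assume neg: "\<not> ?thesis"
  have sf: "squarefree (p * q * r)"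
    using pr ne by (intro squarefree_mult_coprime squarefree_prime) (simp_all add: primes_coprime)
  have sq: "squarefree a" "squarefree b" "squarefree c" "squarefree d"
    using squarefree_mono[OF _ sf] dv a c by (meson dvd_trans)+
  obtain s1 where s1: "prime s1" "s1 dvd a" "\<not> s1 dvd c" using squarefree_prime_not_dvd[OF sq(1)] neg by blast
  obtain s2 where s2: "prime s2" "s2 dvd c" "\<not> s2 dvd a" using squarefree_prime_not_dvd[OF sq(3)] neg by blast
  obtain t1 where t1: "prime t1" "t1 dvd b" "\<not> t1 dvd d" using squarefree_prime_not_dvd[OF sq(2)] neg by blast
  obtain t2 where t2: "prime t2" "t2 dvd d" "\<not> t2 dvd b" using squarefree_prime_not_dvd[OF sq(4)] neg by blast
  have mem: "s \<in> {p, q, r}" if "prime s" "s dvd p * q * r" for s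
    using that pr primes_dvd_imp_eq by (auto simp: prime_dvd_mult_iff)
  have "{s1, s2, t1, t2} \<subseteq> {p, q, r}"
    using mem s1 s2 t1 t2 dv a c by (meson dvd_trans empty_subsetI insert_subset)
  moreover have "card {s1, s2, t1, t2} = 4"
  proof -
    have "s1 \<noteq> s2" "s1 \<noteq> t1" "s1 \<noteq> t2" "s2 \<noteq> t1" "s2 \<noteq> t2" "t1 \<noteq> t2"
      using s1 s2 t1 t2 a c by (meson dvd_trans)+
    then show ?thesis by simp
  qed
  moreover have "card {p, q, r} \<le> 3" by (simp add: card_insert_if)
  ultimately show False using card_mono[of "{p, q, r}" "{s1, s2, t1, t2}"] by simp
qed

lemma eq_prime_power_of_only_prime:
  fixes n :: nat
  assumes "n \<noteq> 0" "prime p" "\<And>s. prime s \<Longrightarrow> s dvd n \<Longrightarrow> s = p"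
  obtains k where "n = p ^ k"
proof -
  obtain m where m: "n = p ^ multiplicity p n * m" "\<not> p dvd m"
    using multiplicity_decompose'[of n p] assms not_prime_unit by (metis mult.commute)
  have "m = 1"
  proof (rule ccontr)
    assume "m \<noteq> 1"
    then obtain s where s: "prime s" "s dvd m" using prime_factor_nat by blast
    then have "s dvd n" using m(1) by (metis dvd_mult)
    then show False using assms(3) s m(2) by blast
  qed
  then show ?thesis using that m by simp
qed

section \<open>Orders and cyclic subgroups\<close>

context group
begin

lemma pow_mem_generate: "y \<in> carrier G \<Longrightarrow> y [^] (k::nat) \<in> generate G {y}"
  using subgroup_int_pow_closed[OF generate_is_subgroup[of "{y}"], of y "int k"] generate.incl[of y "{y}" G]
  by (simp add: int_pow_int)

lemma generate_singleton_closed: "y \<in> carrier G \<Longrightarrow> x \<in> generate G {y} \<Longrightarrow> x \<in> carrier G"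
  using generate_in_carrier[of "{y}" x] by simp

lemma mem_generate_iff:
  assumes "finite (carrier G)" "y \<in> carrier G"
  shows "x \<in> generate G {y} \<longleftrightarrow> (\<exists>k::nat. x = y [^] k)"
  using generate_pow_on_finite_carrier[OF assms] by auto

lemma ord_dvd_of_mem_generate:
  assumes "finite (carrier G)" "y \<in> carrier G" "x \<in> generate G {y}"
  shows "ord x dvd ord y"
proof -
  obtain k :: nat where k: "x = y [^] k" using assms mem_generate_iff by blast
  have "x [^] ord y = \<one>"
    using assms k pow_eq_id by (simp add: nat_pow_pow)
  moreover have "x \<in> carrier G" using k assms by simp
  ultimately show ?thesis using pow_eq_id by simp
qed

lemma ord_pos: "finite (carrier G) \<Longrightarrow> x \<in> carrier G \<Longrightarrow> ord x > 0"
  using ord_ge_1 by fastforce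

lemma ord_pow_div:
  assumes "finite (carrier G)" "x \<in> carrier G" "d dvd ord x"
  shows "ord (x [^] (ord x div d)) = d"
proof -
  obtain e where e: "ord x = d * e" using assms(3) by (rule dvdE)
  moreover have "ord x > 0" using assms ord_pos by blast
  ultimately have "ord x div d = e" "e \<noteq> 0" "ord x div e = d" "e dvd ord x" by auto
  then show ?thesis using ord_pow assms by metis
qed

lemma exists_mem_generate_ord:
  assumes "finite (carrier G)" "x \<in> carrier G" "d dvd ord x"
  obtains y where "y \<in> carrier G" "y \<in> generate G {x}" "ord y = d"
  using ord_pow_div[OF assms] pow_mem_generate[OF assms(2)] assms(2) nat_pow_closed by blast

text \<open>Bezout gives an exponent that is a multiple of \<open>ord y\<close> and one more than a
  multiple of \<open>ord x\<close>. Raising the product to it kills \<open>y\<close> and fixes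
  \<open>x\<close>.\<close>

lemma commuting_coprime_power:
  assumes fin: "finite (carrier G)" and x: "x \<in> carrier G" and y: "y \<in> carrier G"
    and comm: "x \<otimes> y = y \<otimes> x" and cop: "coprime (ord x) (ord y)"
  obtains k :: nat where "(x \<otimes> y) [^] k = x"
proof -
  obtain s t where st: "ord y * s = ord x * t + 1"
    using bezout_nat[of "ord y" "ord x"] ord_pos[OF fin y] cop
    by (metis coprime_commute coprime_iff_gcd_eq_1 neq0_conv)
  have "(x \<otimes> y) [^] (ord y * s) = x [^] (ord y * s) \<otimes> y [^] (ord y * s)"
    using pow_mult_distrib[OF comm x y] .
  also have "y [^] (ord y * s) = \<one>" using y pow_eq_id by simp
  also have "x [^] (ord y * s) = x [^] (ord x * t) \<otimes> x"
    using st x by simp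
  also have "x [^] (ord x * t) = \<one>" using x pow_eq_id by simp
  finally show ?thesis using that x by simp
qed

lemma commuting_coprime_mem_generate:
  assumes "finite (carrier G)" "x \<in> carrier G" "y \<in> carrier G"
    and "x \<otimes> y = y \<otimes> x" "coprime (ord x) (ord y)"
  shows "x \<in> generate G {x \<otimes> y}" "y \<in> generate G {x \<otimes> y}"
proof -
  show "x \<in> generate G {x \<otimes> y}"
    using commuting_coprime_power[OF assms] pow_mem_generate[of "x \<otimes> y"] assms by (metis m_closed)
  have "coprime (ord y) (ord x)" using assms(5) by (simp add: coprime_commute)
  then show "y \<in> generate G {x \<otimes> y}"
    using commuting_coprime_power[of y x] pow_mem_generate[of "x \<otimes> y"] assms by (metis m_closed)
qed

lemma ord_mult_commuting_coprime:
  assumes "finite (carrier G)" "x \<in> carrier G" "y \<in> carrier G"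
    and "x \<otimes> y = y \<otimes> x" "coprime (ord x) (ord y)"
  shows "ord (x \<otimes> y) = ord x * ord y"
proof (rule dvd_antisym)
  show "ord (x \<otimes> y) dvd ord x * ord y" using assms ord_mul_divides by blast
  show "ord x * ord y dvd ord (x \<otimes> y)"
    using commuting_coprime_mem_generate[OF assms] assms ord_dvd_of_mem_generate
    by (meson divides_mult m_closed)
qed

lemma mult_mem_generate:
  assumes "z \<in> carrier G" "x \<in> generate G {z}" "y \<in> generate G {z}"
  shows "x \<otimes> y \<in> generate G {z}"
  using assms by (auto intro: generate.eng)

text \<open>Both factors are powers of \<open>g\<close>. Bezout supplies an exponent divisible by
  \<open>n\<close> and congruent to 1 modulo \<open>m\<close>, and another with the roles exchanged;
  their sum is congruent to 1 modulo \<open>m * n\<close>.\<close>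

lemma coprime_decomposition:
  assumes fin: "finite (carrier G)" and g: "g \<in> carrier G" and ord: "ord g = m * n"
    and cop: "coprime m n"
  obtains u v where "u \<in> generate G {g}" "v \<in> generate G {g}" "g = u \<otimes> v" "ord u = m" "ord v = n"
    "u \<otimes> v = v \<otimes> u"
proof -
  have pos: "m > 0" "n > 0" using ord_pos[OF fin g] ord by auto
  obtain s t where st: "m * s = n * t + 1"
    using bezout_nat[of m n] pos cop by (metis coprime_iff_gcd_eq_1 neq0_conv)
  obtain s' t' where st': "n * s' = m * t' + 1"
    using bezout_nat[of n m] pos cop by (metis coprime_commute coprime_iff_gcd_eq_1 neq0_conv)
  define u v where "u = g [^] (n * s')" and "v = g [^] (m * s)"
  have uv: "u \<in> generate G {g}" "v \<in> generate G {g}" "u \<in> carrier G" "v \<in> carrier G"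
    using g pow_mem_generate by (auto simp: u_def v_def)
  have comm: "u \<otimes> v = v \<otimes> u"
    using g by (simp add: u_def v_def nat_pow_mult add.commute)
  have "n * s' + m * s = m * (t' + s) + 1" "n * s' + m * s = n * (t + s') + 1"
    using st st' by (auto simp: algebra_simps)
  \<comment> \<open>The fact \<open>gt\<close> ensures that the subtraction of 1 on natural numbers
    is not truncated.\<close>
  then have "n * s' + m * s - 1 = m * (t' + s)" "n * s' + m * s - 1 = n * (t + s')"
    and gt: "n * s' + m * s > 0" by linarith+
  then have "m dvd n * s' + m * s - 1" "n dvd n * s' + m * s - 1"
    by (metis dvd_triv_left)+
  then have "m * n dvd n * s' + m * s - 1" using cop by (simp add: divides_mult)
  then have "g [^] (n * s' + m * s - 1) = \<one>" using g ord pow_eq_id by simp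
  then have "g [^] Suc (n * s' + m * s - 1) = g" using g by simp
  moreover have "Suc (n * s' + m * s - 1) = n * s' + m * s" using gt by simp
  ultimately have guv: "g = u \<otimes> v" using g by (simp only: u_def v_def nat_pow_mult)
  have "u [^] m = g [^] (ord g * s')" "v [^] n = g [^] (ord g * s)"
    using g ord by (simp_all add: u_def v_def nat_pow_pow mult_ac)
  then have "u [^] m = \<one>" "v [^] n = \<one>" using g pow_eq_id[of g] by simp_all
  then have d: "ord u dvd m" "ord v dvd n" using uv pow_eq_id[of u] pow_eq_id[of v] by simp_all
  moreover have "m * n dvd ord u * ord v"
    using ord_mul_divides[OF comm] uv ord guv by simp
  \<comment> \<open>The orders divide \<open>m\<close> and \<open>n\<close>, while their product is
    a multiple of \<open>m * n\<close>, so neither can be a proper divisor.\<close>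
  ultimately have "ord u = m \<and> ord v = n"
  proof -
    obtain a where a: "m = ord u * a" using d(1) by (rule dvdE)
    obtain b where b: "n = ord v * b" using d(2) by (rule dvdE)
    obtain c where "ord u * ord v = m * n * c" using \<open>m * n dvd ord u * ord v\<close> by (rule dvdE)
    then have "ord u * ord v * 1 = ord u * ord v * (a * b * c)" using a b by (simp add: mult_ac)
    moreover have "ord u * ord v \<noteq> 0" using pos a b by auto
    ultimately have "a * b * c = 1" by (metis mult_cancel_left)
    then show ?thesis using a b by simp
  qed
  then show ?thesis using that uv guv comm by blast
qed

text \<open>A finite cyclic group has only one subgroup of each order, so inside it membership is
  decided by divisibility of orders. This converse of \<open>ord_dvd_of_mem_generate\<close> carries
  most comparisons of cyclic subgroups below.\<close>

lemma cyclic_mem_generate_of_ord_dvd: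
  assumes fin: "finite (carrier G)" and g: "g \<in> carrier G"
    and x: "x \<in> generate G {g}" and y: "y \<in> generate G {g}" and dvd: "ord x dvd ord y"
  shows "x \<in> generate G {y}"
proof -
  obtain i j :: nat where ij: "x = g [^] i" "y = g [^] j" using assms mem_generate_iff by metis
  have car: "x \<in> carrier G" "y \<in> carrier G" using ij g by auto
  have N: "ord g > 0" using ord_pos fin g by blast
  show ?thesis
  proof (cases "j = 0")
    case True
    then have "ord y = 1" using ij by simp
    then have "ord x = 1" using dvd by simp
    then have "x = \<one>" using car ord_eq_1 by blast
    then show ?thesis by (simp add: generate.one)
  next
    case False
    define d where "d = gcd j (ord g)"
    have d: "d dvd ord g" "d > 0" using False by (auto simp: d_def)
    have "ord y = ord g div d" using ord_pow_gen[OF g, of j] ij False by (simp add: d_def gcd.commute)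
    moreover have "g [^] (i * ord y) = \<one>"
      using dvd ij g car pow_eq_id[of x] by (simp add: nat_pow_pow)
    ultimately have "ord g dvd i * (ord g div d)" using g pow_eq_id by metis
    moreover obtain n where n: "ord g = d * n" using d(1) by (rule dvdE)
    ultimately have "d * n dvd i * n" using d(2) by simp
    then have "d dvd i" using N n by simp
    then obtain e where e: "i = d * e" by (elim dvdE)
    \<comment> \<open>Bezout exhibits \<open>g [^] d\<close> as a power of \<open>y\<close>;
      multiplying the equation by \<open>e\<close> produces the exponent \<open>i\<close> of
      \<open>x\<close>.\<close>
    obtain s t where "j * s = ord g * t + d"
      using bezout_nat[of j "ord g"] False by (auto simp: d_def)
    then have "j * (s * e) = ord g * (t * e) + i" using e by (metis add_mult_distrib mult.assoc)
    then have "y [^] (s * e) = g [^] (ord g * (t * e)) \<otimes> x"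
      using ij g by (simp add: nat_pow_pow nat_pow_mult)
    also have "g [^] (ord g * (t * e)) = \<one>" using g pow_eq_id by simp
    finally have "y [^] (s * e) = x" using car by simp
    then show ?thesis using pow_mem_generate[OF car(2)] by metis
  qed
qed

section \<open>Orders in subgroups and elements of prime power order\<close>

lemma ord_subgroup:
  assumes "subgroup H G"
  shows "group.ord (G\<lparr>carrier := H\<rparr>) x = ord x"
proof -
  interpret H: group "G\<lparr>carrier := H\<rparr>" using assms by (rule subgroup_imp_group)
  have "(x [^]\<^bsub>G\<lparr>carrier := H\<rparr>\<^esub> n = \<one>) = (x [^] n = \<one>)" for n :: nat
    using nat_pow_consistent[of x n H] by simp
  then show ?thesis by (simp add: ord_def H.ord_def)
qed

lemma ord_dvd_card_subgroup:
  assumes "subgroup H G" "x \<in> H"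
  shows "ord x dvd card H"
proof -
  interpret H: group "G\<lparr>carrier := H\<rparr>" using assms by (intro subgroup_imp_group)
  have "group.ord (G\<lparr>carrier := H\<rparr>) x dvd order (G\<lparr>carrier := H\<rparr>)"
    using assms(2) by (intro H.ord_dvd_group_order) simp
  moreover have "order (G\<lparr>carrier := H\<rparr>) = card H" by (simp add: order_def)
  ultimately show ?thesis by (simp only: ord_subgroup[OF assms(1)])
qed

text \<open>Cauchy's theorem. In \<open>sylow_thm\<close> the cofactor \<open>m\<close> may still be
  divisible by \<open>p\<close>, so the exponent 1 is allowed; a nontrivial element of a subgroup of
  order \<open>p\<close> has order \<open>p\<close>.\<close>

lemma exists_ord_prime:
  assumes fin: "finite (carrier G)" and p: "prime p" "p dvd order G"
  obtains x where "x \<in> carrier G" "ord x = p"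
proof -
  obtain m where "order G = p * m" using p(2) by (rule dvdE)
  then have m: "order G = p ^ 1 * m" by simp
  obtain H where H: "subgroup H G" and "card H = p ^ 1"
    using sylow_thm[OF p(1) is_group m fin] by blast
  then have card: "card H = p" by simp
  have "\<not> H \<subseteq> {\<one>}"
  proof
    assume "H \<subseteq> {\<one>}"
    then have "card H \<le> card {\<one>}" by (intro card_mono) simp
    then show False using card prime_gt_1_nat[OF p(1)] by simp
  qed
  then obtain x where x: "x \<in> H" "x \<noteq> \<one>" by blast
  then have car: "x \<in> carrier G" using H by (intro subgroup.mem_carrier)
  have "ord x \<noteq> 1" using x(2) ord_eq_1[OF car] by simp
  moreover have "ord x dvd p" using ord_dvd_card_subgroup[OF H x(1)] card by simp
  ultimately have "ord x = p" using p(1) by (metis prime_nat_iff)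
  then show ?thesis by (rule that[OF car])
qed

text \<open>Strong induction on the order: an element is the product of one of prime power order and
  one of smaller order.\<close>

lemma subgroup_eq_carrier_of_prime_power_elements:
  assumes fin: "finite (carrier G)" and H: "subgroup H G"
    and pp: "\<And>w s k. w \<in> carrier G \<Longrightarrow> prime s \<Longrightarrow> ord w = s ^ k \<Longrightarrow> w \<in> H"
  shows "H = carrier G"
proof
  show "H \<subseteq> carrier G" using H by (rule subgroup.subset)
  have "g \<in> carrier G \<Longrightarrow> ord g = n \<Longrightarrow> g \<in> H" for g n
  proof (induction n arbitrary: g rule: less_induct)
    case (less n)
    show ?case
    proof (cases "n = 1")
      case True
      then have "g = \<one>" using less.prems ord_eq_1 by blast
      then show ?thesis using H by (simp add: subgroup.one_closed)
    next
      case False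
      have "n \<noteq> 0" using less.prems ord_pos[OF fin] by blast
      then obtain s k m where skm: "prime s" "n = s ^ k * m" "coprime (s ^ k) m" "m < n"
        using False prime_power_factorE by metis
      obtain u v where uv: "u \<in> generate G {g}" "v \<in> generate G {g}" "g = u \<otimes> v"
          "ord u = s ^ k" "ord v = m"
        using coprime_decomposition[OF fin less.prems(1) _ skm(3)] less.prems(2) skm(2) by metis
      then have "u \<in> carrier G" "v \<in> carrier G" using less.prems generate_singleton_closed by auto
      then have "u \<in> H" "v \<in> H" using pp[of u s k] less.IH[of m v] uv skm by auto
      then show ?thesis using uv H by (simp add: subgroup.m_closed)
    qed
  qed
  then show "carrier G \<subseteq> H" by blast
qed

text \<open>The working form of \<open>C4_free\<close>. Neither of two distinct primes divides the
  other, so \<open>x\<close> and \<open>y\<close> are non-adjacent and can serve as one opposite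
  pair of a four-cycle.\<close>

lemma C4_free_comparable:
  assumes C4: "C4_free (power_graph G)" and fin: "finite (carrier G)"
    and b: "b \<in> carrier G" and d: "d \<in> carrier G"
    and x: "x \<in> generate G {b}" "x \<in> generate G {d}" "prime (ord x)"
    and y: "y \<in> generate G {b}" "y \<in> generate G {d}" "prime (ord y)"
    and ne: "ord x \<noteq> ord y"
  shows "b \<in> generate G {d} \<or> d \<in> generate G {b}"
proof -
  have car: "x \<in> carrier G" "y \<in> carrier G" using b x y generate_singleton_closed by auto
  have "x \<notin> generate G {y}" "y \<notin> generate G {x}"
    using ord_dvd_of_mem_generate[OF fin] car x(3) y(3) ne primes_dvd_imp_eq by metis+
  then show ?thesis
    using C4[unfolded C4_free_power_graph_iff] car b d x y by blast
qed

section \<open>Finite cyclic groups and the exponent\<close>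

lemma cyclic_iso_integer_mod_group:
  assumes fin: "finite (carrier G)" and g: "g \<in> carrier G" and gen: "carrier G = generate G {g}"
  shows "G \<cong> integer_mod_group (ord g)"
proof -
  let ?Z = "integer_mod_group (ord g)"
  have n: "ord g > 0" using ord_pos fin g by blast
  have "(\<lambda>i. g [^] (i::int)) \<in> iso ?Z G"
  proof (rule isoI)
    show "(\<lambda>i. g [^] (i::int)) \<in> hom ?Z G"
    proof (rule homI)
      fix i j :: int
      show "g [^] (i \<otimes>\<^bsub>?Z\<^esub> j) = g [^] i \<otimes> g [^] j"
        using g int_pow_eq[OF g, of "(i + j) mod int (ord g)" "i + j"]
        by (simp add: int_pow_mult flip: minus_mod_eq_mult_div)
    qed (use g in simp)
    show "bij_betw (\<lambda>i. g [^] (i::int)) (carrier ?Z) (carrier G)"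
      unfolding bij_betw_def
    proof
      show "inj_on (\<lambda>i. g [^] (i::int)) (carrier ?Z)"
      proof (rule inj_onI)
        fix i j :: int
        assume ij: "i \<in> carrier ?Z" "j \<in> carrier ?Z" "g [^] i = g [^] j"
        then have "int (ord g) dvd j - i" using int_pow_eq[OF g] by blast
        moreover have "\<bar>j - i\<bar> < int (ord g)" using ij n by (auto simp: carrier_integer_mod_group)
        ultimately show "i = j" using dvd_imp_le_int[of "j - i" "int (ord g)"] by force
      qed
      show "(\<lambda>i. g [^] (i::int)) ` carrier ?Z = carrier G"
      proof
        show "(\<lambda>i. g [^] (i::int)) ` carrier ?Z \<subseteq> carrier G" using g by auto
        show "carrier G \<subseteq> (\<lambda>i. g [^] (i::int)) ` carrier ?Z"
        proof
          fix x assume "x \<in> carrier G"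
          then obtain k :: int where k: "x = g [^] k" using gen generate_pow[OF g] by auto
          have "g [^] (k mod int (ord g)) = x"
            unfolding k using int_pow_eq[OF g] by (simp flip: minus_mod_eq_mult_div)
          moreover have "k mod int (ord g) \<in> carrier ?Z" using n by (simp add: carrier_integer_mod_group)
          ultimately show "x \<in> (\<lambda>i. g [^] (i::int)) ` carrier ?Z" by blast
        qed
      qed
    qed
  qed
  then have "?Z \<cong> G" by (auto simp: is_iso_def)
  then show ?thesis by (simp add: group.iso_sym)
qed

text \<open>The assumption \<open>n > 1\<close> makes 1 a residue, and it generates
  \<open>?Z\<close>. Cyclicity is carried over by the isomorphism, and the order of a generator is
  read off from the cardinality.\<close>

lemma iso_integer_mod_group_generator:
  assumes n: "n > 1" and iso: "G \<cong> integer_mod_group n"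
  obtains g where "g \<in> carrier G" "carrier G = generate G {g}" "ord g = n"
proof -
  let ?Z = "integer_mod_group n"
  interpret Z: group ?Z by simp
  have "carrier ?Z = range (\<lambda>k::int. 1 [^]\<^bsub>?Z\<^esub> k)"
  proof
    show "carrier ?Z \<subseteq> range (\<lambda>k::int. 1 [^]\<^bsub>?Z\<^esub> k)"
    proof
      fix x assume "x \<in> carrier ?Z"
      then have "x = 1 [^]\<^bsub>?Z\<^esub> x" using n by (simp add: int_pow_integer_mod_group carrier_integer_mod_group)
      then show "x \<in> range (\<lambda>k::int. 1 [^]\<^bsub>?Z\<^esub> k)" by blast
    qed
    show "range (\<lambda>k::int. 1 [^]\<^bsub>?Z\<^esub> k) \<subseteq> carrier ?Z"
      using n by (auto simp: int_pow_integer_mod_group carrier_integer_mod_group)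
  qed
  then have "cyclic_group ?Z" unfolding Z.cyclic_group using n by (intro bexI[of _ 1]) auto
  then have "cyclic_group G" using isomorphic_group_cyclicity[OF iso is_group Z.is_group] by simp
  then obtain g where "g \<in> carrier G" "carrier G = range (\<lambda>n::int. g [^] n)"
    unfolding cyclic_group by blast
  moreover from this have "generate G {g} = range (\<lambda>n::int. g [^] n)" using generate_pow by auto
  ultimately have g: "g \<in> carrier G" "carrier G = generate G {g}" by simp_all
  have "card (carrier G) = card (carrier ?Z)" using iso by (rule iso_same_card)
  then have "ord g = n" using generate_pow_card[OF g(1)] g(2) n by (simp add: carrier_integer_mod_group)
  then show ?thesis using that g by blast
qed

text \<open>The nontrivial \<open>y\<close> has order \<open>q\<close>, which bounds every
  admissible exponent from below.\<close>

lemma group_exponent_eq_prime: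
  assumes q: "prime q" and pow: "\<And>x. x \<in> carrier G \<Longrightarrow> x [^] q = \<one>"
    and y: "y \<in> carrier G" "y \<noteq> \<one>"
  shows "group_exponent G = q"
  unfolding group_exponent_def
proof (rule Least_equality)
  show "0 < q \<and> (\<forall>x\<in>carrier G. x [^] q = \<one>)" using pow prime_gt_0_nat[OF q] by blast
  fix n :: nat assume n: "0 < n \<and> (\<forall>x\<in>carrier G. x [^] n = \<one>)"
  have "ord y dvd q" using pow y pow_eq_id by blast
  moreover have "ord y \<noteq> 1" using y ord_eq_1 by blast
  ultimately have "ord y = q" using q prime_nat_iff by metis
  moreover have "ord y dvd n" using n y pow_eq_id by blast
  ultimately show "q \<le> n" using n by (simp add: dvd_imp_le)
qed

text \<open>The \<open>LEAST\<close> in the definition is meaningful once an admissible exponent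
  exists; the group order is one.\<close>

lemma pow_group_exponent:
  assumes "finite (carrier G)" "x \<in> carrier G"
  shows "x [^] group_exponent G = \<one>"
proof -
  have "0 < order G \<and> (\<forall>x \<in> carrier G. x [^] order G = \<one>)"
    using assms pow_order_eq_1 order_gt_0_iff_finite by blast
  then have "0 < group_exponent G \<and> (\<forall>x \<in> carrier G. x [^] group_exponent G = \<one>)"
    unfolding group_exponent_def by (rule LeastI)
  then show ?thesis using assms by blast
qed

end

section \<open>Nilpotent groups\<close>

context group
begin

section \<open>Commutators and the lower central series\<close>

lemma inv_mult_cancel_left:
  "x \<in> carrier G \<Longrightarrow> y \<in> carrier G \<Longrightarrow> inv x \<otimes> (x \<otimes> y) = y"
  by (simp flip: m_assoc)

text \<open>The relation says that \<open>c\<close> is the commutator of \<open>x\<close> and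
  \<open>y\<close>, written without inverses. If it commutes with \<open>x\<close>, then the
  commutator of the power \<open>x [^] n\<close> with \<open>y\<close> is
  \<open>c [^] n\<close>.\<close>

lemma pow_commutator_left:
  assumes "x \<in> carrier G" "y \<in> carrier G" "c \<in> carrier G"
    and "x \<otimes> y = c \<otimes> (y \<otimes> x)" "c \<otimes> x = x \<otimes> c"
  shows "x [^] (n::nat) \<otimes> y = c [^] n \<otimes> (y \<otimes> x [^] n)"
proof (induction n)
  case (Suc n)
  have cx: "x [^] n \<otimes> c = c \<otimes> x [^] n" using group_commutes_pow[of x c n] assms by simp
  have "x [^] Suc n \<otimes> y = x [^] n \<otimes> (x \<otimes> y)" using assms by (simp add: m_assoc)
  also have "\<dots> = (x [^] n \<otimes> c) \<otimes> (y \<otimes> x)" using assms by (simp add: m_assoc)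
  also have "\<dots> = c \<otimes> ((x [^] n \<otimes> y) \<otimes> x)" using assms cx by (simp add: m_assoc)
  also have "\<dots> = (c \<otimes> c [^] n) \<otimes> (y \<otimes> (x [^] n \<otimes> x))" using assms Suc.IH by (simp add: m_assoc)
  also have "c \<otimes> c [^] n = c [^] Suc n" using assms nat_pow_Suc2 by simp
  finally show ?case by simp
qed (use assms in simp)

lemma pow_commutator_right:
  assumes "x \<in> carrier G" "y \<in> carrier G" "c \<in> carrier G"
    and "x \<otimes> y = c \<otimes> (y \<otimes> x)" "c \<otimes> y = y \<otimes> c"
  shows "x \<otimes> y [^] (n::nat) = c [^] n \<otimes> (y [^] n \<otimes> x)"
proof (induction n)
  case (Suc n)
  have cy: "y [^] n \<otimes> c = c \<otimes> y [^] n" using group_commutes_pow[of y c n] assms by simp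
  have "x \<otimes> y [^] Suc n = (x \<otimes> y [^] n) \<otimes> y" using assms by (simp add: m_assoc)
  also have "\<dots> = c [^] n \<otimes> (y [^] n \<otimes> (x \<otimes> y))" using assms(1-3) Suc.IH by (simp add: m_assoc)
  also have "\<dots> = c [^] n \<otimes> ((y [^] n \<otimes> c) \<otimes> (y \<otimes> x))" using assms by (simp add: m_assoc)
  also have "\<dots> = (c [^] n \<otimes> c) \<otimes> ((y [^] n \<otimes> y) \<otimes> x)" using assms(1-3) cy by (simp add: m_assoc)
  finally show ?case by simp
qed (use assms in simp)

text \<open>A commutator commuting with both entries turns powers of either entry into its own
  powers. So \<open>c\<close> is killed by both \<open>m\<close> and \<open>n\<close>.\<close>

lemma commutator_coprime_eq_one:
  assumes x: "x \<in> carrier G" and y: "y \<in> carrier G" and c: "c \<in> carrier G"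
    and xy: "x \<otimes> y = c \<otimes> (y \<otimes> x)" and cx: "c \<otimes> x = x \<otimes> c" and cy: "c \<otimes> y = y \<otimes> c"
    and pow: "x [^] (m::nat) = \<one>" "y [^] (n::nat) = \<one>" and cop: "coprime m n"
  shows "c = \<one>"
proof -
  have "y = c [^] m \<otimes> y" using pow_commutator_left[OF x y c xy cx, of m] pow(1) x y c by simp
  then have "c [^] m = \<one>" using y c by (metis nat_pow_closed r_cancel_one')
  moreover have "x = c [^] n \<otimes> x" using pow_commutator_right[OF x y c xy cy, of n] pow(2) x y c by simp
  then have "c [^] n = \<one>" using x c by (metis nat_pow_closed r_cancel_one')
  ultimately have "ord c dvd m" "ord c dvd n" using c pow_eq_id by simp_all
  then have "ord c = 1" using cop coprime_common_divisor_nat by blast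
  then show ?thesis using c ord_eq_1 by blast
qed

text \<open>A conjugate of a commutator is the commutator of the conjugates, and the second entry
  stays in the previous term by induction.\<close>

lemma normal_lower_central_series: "lower_central_series G n \<lhd> G"
proof (induction n)
  case 0
  show ?case by (simp add: normal_inv_iff subgroup_self)
next
  case (Suc n)
  interpret N: normal "lower_central_series G n" G by (rule Suc.IH)
  show ?case
    unfolding lower_central_series.simps
  proof (rule normal_generateI)
    show "{x \<otimes> y \<otimes> inv x \<otimes> inv y |x y. x \<in> carrier G \<and> y \<in> lower_central_series G n} \<subseteq> carrier G"
      by auto
  next
    fix h g
    assume "h \<in> {x \<otimes> y \<otimes> inv x \<otimes> inv y |x y. x \<in> carrier G \<and> y \<in> lower_central_series G n}"
      and g: "g \<in> carrier G"
    then obtain x y where xy: "h = x \<otimes> y \<otimes> inv x \<otimes> inv y" "x \<in> carrier G" "y \<in> lower_central_series G n"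
      by blast
    define x' y' where "x' = g \<otimes> x \<otimes> inv g" and "y' = g \<otimes> y \<otimes> inv g"
    have y: "y \<in> carrier G" using xy by simp
    have "g \<otimes> h \<otimes> inv g = x' \<otimes> y' \<otimes> inv x' \<otimes> inv y'"
      using xy(2) y g unfolding xy(1) x'_def y'_def
      by (simp add: inv_mult_group m_assoc inv_mult_cancel_left)
    moreover have "x' \<in> carrier G" using xy g by (simp add: x'_def)
    moreover have "y' \<in> lower_central_series G n"
      using N.inv_op_closed2[OF g xy(3)] by (simp add: y'_def)
    ultimately show "g \<otimes> h \<otimes> inv g \<in>
      {x \<otimes> y \<otimes> inv x \<otimes> inv y |x y. x \<in> carrier G \<and> y \<in> lower_central_series G n}"
      by blast
  qed
qed

lemma commutator_mem_lower_central_series: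
  assumes "x \<in> carrier G" "y \<in> lower_central_series G n"
  shows "x \<otimes> y \<otimes> inv x \<otimes> inv y \<in> lower_central_series G (Suc n)"
  using assms by (auto intro!: generate.incl)

lemma commutator_eq_one_iff:
  assumes "x \<in> carrier G" "y \<in> carrier G"
  shows "x \<otimes> y \<otimes> inv x \<otimes> inv y = \<one> \<longleftrightarrow> x \<otimes> y = y \<otimes> x"
proof -
  have "x \<otimes> y \<otimes> inv x \<otimes> inv y = (x \<otimes> y) \<otimes> inv (y \<otimes> x)"
    using assms by (simp add: inv_mult_group m_assoc)
  then show ?thesis using assms by (metis inv_closed inv_equality inv_inv m_closed r_inv)
qed

text \<open>
  Modulo the next term of the lower central series the commutator \<open>[x, y]\<close> is central, hence
  \<open>[x, y] ^ m = [x ^ m, y] = 1\<close> and likewise \<open>[x, y] ^ n = 1\<close>. So \<open>[x, y]\<close> descends through the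
  whole series.
\<close>
lemma nilpotent_coprime_commute:
  assumes nil: "nilpotent_group G" and x: "x \<in> carrier G" and y: "y \<in> carrier G"
    and cop: "coprime (ord x) (ord y)"
  shows "x \<otimes> y = y \<otimes> x"
proof -
  define c where "c = x \<otimes> y \<otimes> inv x \<otimes> inv y"
  have c: "c \<in> carrier G" using x y by (simp add: c_def)
  have xy: "x \<otimes> y = c \<otimes> (y \<otimes> x)" using x y by (simp add: c_def m_assoc inv_mult_cancel_left)
  have "c \<in> lower_central_series G k" for k
  proof (induction k)
    case 0
    then show ?case using c by simp
  next
    case (Suc k)
    define N where "N = lower_central_series G (Suc k)"
    interpret N: normal N G unfolding N_def by (rule normal_lower_central_series)
    interpret Q: group "G Mod N" by (rule N.factorgroup_is_group)
    interpret h: group_hom G "G Mod N" "\<lambda>a. N #> a"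
      by unfold_locales (rule N.r_coset_hom_Mod)
    have one: "N #> a = \<one>\<^bsub>G Mod N\<^esub> \<longleftrightarrow> a \<in> N" if "a \<in> carrier G" for a
      using that N.rcos_const coset_join1[OF _ that] N.subset N.is_subgroup by (auto simp: FactGroup_def)
    have central: "(N #> c) \<otimes>\<^bsub>G Mod N\<^esub> (N #> g) = (N #> g) \<otimes>\<^bsub>G Mod N\<^esub> (N #> c)"
      if g: "g \<in> carrier G" for g
    proof -
      have "g \<otimes> c \<otimes> inv g \<otimes> inv c \<in> N"
        unfolding N_def using g Suc.IH by (rule commutator_mem_lower_central_series)
      then have "N #> (g \<otimes> c \<otimes> inv g \<otimes> inv c) = \<one>\<^bsub>G Mod N\<^esub>"
        using g c by (intro iffD2[OF one] m_closed inv_closed)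
      moreover have "N #> (g \<otimes> c \<otimes> inv g \<otimes> inv c) = (N #> g) \<otimes>\<^bsub>G Mod N\<^esub> (N #> c)
          \<otimes>\<^bsub>G Mod N\<^esub> inv\<^bsub>G Mod N\<^esub> (N #> g) \<otimes>\<^bsub>G Mod N\<^esub> inv\<^bsub>G Mod N\<^esub> (N #> c)"
        using g c by (simp only: h.hom_mult h.hom_inv m_closed inv_closed)
      ultimately show ?thesis
        using Q.commutator_eq_one_iff[OF h.hom_closed[OF g] h.hom_closed[OF c]] by simp
    qed
    have "N #> c = \<one>\<^bsub>G Mod N\<^esub>"
    proof (rule Q.commutator_coprime_eq_one[OF h.hom_closed[OF x] h.hom_closed[OF y] h.hom_closed[OF c] _
          central[OF x] central[OF y] _ _ cop])
      show "(N #> x) \<otimes>\<^bsub>G Mod N\<^esub> (N #> y) = (N #> c) \<otimes>\<^bsub>G Mod N\<^esub> ((N #> y) \<otimes>\<^bsub>G Mod N\<^esub> (N #> x))"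
        using h.hom_mult x y c xy by (metis m_closed)
      show "(N #> x) [^]\<^bsub>G Mod N\<^esub> ord x = \<one>\<^bsub>G Mod N\<^esub>"
        using h.hom_nat_pow[OF x, of "ord x"] h.hom_one x by (simp only: pow_ord_eq_1)
      show "(N #> y) [^]\<^bsub>G Mod N\<^esub> ord y = \<one>\<^bsub>G Mod N\<^esub>"
        using h.hom_nat_pow[OF y, of "ord y"] h.hom_one y by (simp only: pow_ord_eq_1)
    qed
    then show ?case using one[OF c] by (simp add: N_def)
  qed
  moreover obtain k where "lower_central_series G k = {\<one>}" using nil by (auto simp: nilpotent_group_def)
  ultimately have "c = \<one>" by blast
  then show ?thesis using commutator_eq_one_iff[OF x y] by (simp add: c_def)
qed

text \<open>Take the last term of the lower central series that meets \<open>P\<close> nontrivially.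
  Commutators of its elements in \<open>P\<close> with any \<open>g\<close> lie in \<open>P\<close>
  and in the next term, hence are trivial.\<close>

lemma nilpotent_normal_inter_center:
  assumes nil: "nilpotent_group G" and P: "P \<lhd> G" and nontriv: "P \<noteq> {\<one>}"
  obtains w where "w \<in> P" "w \<noteq> \<one>" "\<And>g. g \<in> carrier G \<Longrightarrow> g \<otimes> w = w \<otimes> g"
proof -
  interpret P: normal P G by (rule P)
  obtain n where "lower_central_series G n = {\<one>}" using nil by (auto simp: nilpotent_group_def)
  then have ex: "\<exists>n. P \<inter> lower_central_series G n \<subseteq> {\<one>}" by auto
  define n where "n = (LEAST n. P \<inter> lower_central_series G n \<subseteq> {\<one>})"
  have n: "P \<inter> lower_central_series G n \<subseteq> {\<one>}" unfolding n_def using ex by (rule LeastI_ex)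
  have "n \<noteq> 0"
  proof
    assume "n = 0"
    then have "P \<subseteq> {\<one>}" using n P.subset by auto
    then show False using nontriv P.one_closed by auto
  qed
  then obtain k where k: "n = Suc k" using not0_implies_Suc by blast
  then have "\<not> P \<inter> lower_central_series G k \<subseteq> {\<one>}"
    unfolding n_def using not_less_Least by (metis lessI)
  then obtain w where w: "w \<in> P" "w \<in> lower_central_series G k" "w \<noteq> \<one>" by blast
  have "g \<otimes> w = w \<otimes> g" if g: "g \<in> carrier G" for g
  proof -
    have "g \<otimes> w \<otimes> inv g \<otimes> inv w \<in> lower_central_series G n"
      unfolding k using g w by (intro commutator_mem_lower_central_series)
    \<comment> \<open>This commutator is a conjugate of \<open>w\<close> times \<open>inv w\<close>,
      and both factors are in the normal subgroup \<open>P\<close>.\<close>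
    moreover have "g \<otimes> w \<otimes> inv g \<otimes> inv w \<in> P"
      using P.m_closed[OF P.inv_op_closed2[OF g w(1)] P.m_inv_closed[OF w(1)]] .
    ultimately have "g \<otimes> w \<otimes> inv g \<otimes> inv w = \<one>" using n by blast
    then show ?thesis using commutator_eq_one_iff g w(1) by simp
  qed
  then show ?thesis using that w by blast
qed

end

section \<open>Groups with a \<open>C\<^sub>4\<close>-free power graph\<close>

context group
begin

section \<open>Orders divisible by three primes\<close>

text \<open>The cyclic groups of \<open>x \<otimes> y \<otimes> w\<close> and
  \<open>x \<otimes> y \<otimes> z\<close> share \<open>x\<close> and \<open>y\<close>, so they are
  comparable. The inclusion in the unwanted direction forces \<open>s = r\<close>, and is handled by
  a second comparison based on \<open>x\<close> and \<open>z\<close>.\<close>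

lemma prime_power_mem_generate_of_three_primes:
  assumes C4: "C4_free (power_graph G)" and fin: "finite (carrier G)"
    and comm: "\<forall>x\<in>carrier G. \<forall>y\<in>carrier G. coprime (ord x) (ord y) \<longrightarrow> x \<otimes> y = y \<otimes> x"
    and pr: "prime p" "prime q" "prime r" and ne: "p \<noteq> q" "p \<noteq> r" "q \<noteq> r"
    and x: "x \<in> carrier G" "ord x = p" and y: "y \<in> carrier G" "ord y = q"
    and z: "z \<in> carrier G" "ord z = r"
    and w: "w \<in> carrier G" "ord w = s ^ k" "prime s" "s \<noteq> p" "s \<noteq> q"
  shows "w \<in> generate G {x \<otimes> y \<otimes> z}"
proof (cases "k = 0")
  case True
  then have "w = \<one>" using w ord_eq_1 by simp
  then show ?thesis by (simp add: generate.one)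
next
  case False
  note cc = comm[rule_format]
  have cop: "coprime p q" "coprime p r" "coprime q r" "coprime p s" "coprime q s"
    using pr ne w by (auto simp: primes_coprime)
  have xy: "x \<otimes> y = y \<otimes> x" using cc[OF x(1) y(1)] x(2) y(2) cop(1) by metis
  have gxy: "x \<in> generate G {x \<otimes> y}" "y \<in> generate G {x \<otimes> y}"
    using commuting_coprime_mem_generate[OF fin x(1) y(1) xy] x y cop by simp_all
  have oxy: "ord (x \<otimes> y) = p * q" and cxy: "x \<otimes> y \<in> carrier G"
    using ord_mult_commuting_coprime[OF fin x(1) y(1) xy] x y cop by simp_all
  define b d where "b = x \<otimes> y \<otimes> w" and "d = x \<otimes> y \<otimes> z"
  have b: "b \<in> carrier G" and d: "d \<in> carrier G" using x y z w by (simp_all add: b_def d_def)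
  have cw: "coprime (ord (x \<otimes> y)) (ord w)" and cz: "coprime (ord (x \<otimes> y)) (ord z)"
    using oxy w z cop by simp_all
  have gb: "x \<otimes> y \<in> generate G {b}" "w \<in> generate G {b}" and ob: "ord b = p * q * s ^ k"
    using commuting_coprime_mem_generate[OF fin cxy w(1) cc[OF cxy w(1) cw] cw]
      ord_mult_commuting_coprime[OF fin cxy w(1) cc[OF cxy w(1) cw] cw] oxy w by (simp_all add: b_def)
  have gd: "x \<otimes> y \<in> generate G {d}" "z \<in> generate G {d}"
    using commuting_coprime_mem_generate[OF fin cxy z(1) cc[OF cxy z(1) cz] cz] by (simp_all add: d_def)
  have xyb: "x \<in> generate G {b}" "y \<in> generate G {b}" and xyd: "x \<in> generate G {d}" "y \<in> generate G {d}"
    using gxy gb gd b d generate_singleton_trans by blast+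
  have "b \<in> generate G {d} \<or> d \<in> generate G {b}"
    using C4_free_comparable[OF C4 fin b d xyb(1) xyd(1) _ xyb(2) xyd(2)] x y pr ne by simp
  then have "w \<in> generate G {d}"
  proof
    assume "b \<in> generate G {d}"
    then show ?thesis using gb d generate_singleton_trans by blast
  next
    assume "d \<in> generate G {b}"
    then have zb: "z \<in> generate G {b}" using gd b generate_singleton_trans by blast
    then have "r dvd p * q * s ^ k" using ord_dvd_of_mem_generate[OF fin b zb] ob z by simp
    then have rs: "r = s"
      using pr ne w(3) by (metis prime_dvd_mult_iff prime_dvd_power primes_dvd_imp_eq)
    have "ord z dvd ord w" using z w rs False by simp
    then have zw: "z \<in> generate G {w}"
      using cyclic_mem_generate_of_ord_dvd[OF fin b zb gb(2)] by blast
    have cxw: "coprime (ord x) (ord w)" using x w cop by simp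
    \<comment> \<open>Without the factor \<open>y\<close>, the group of \<open>e\<close> still
      shares \<open>x\<close> and \<open>z\<close> with that of \<open>d\<close>, but it cannot
      contain \<open>d\<close>, since \<open>q\<close> does not divide \<open>ord e\<close>.\<close>
    define e where "e = x \<otimes> w"
    have e: "e \<in> carrier G" using x w by (simp add: e_def)
    have ge: "x \<in> generate G {e}" "w \<in> generate G {e}" and oe: "ord e = p * s ^ k"
      using commuting_coprime_mem_generate[OF fin x(1) w(1) cc[OF x(1) w(1) cxw] cxw]
        ord_mult_commuting_coprime[OF fin x(1) w(1) cc[OF x(1) w(1) cxw] cxw] x w by (simp_all add: e_def)
    have ze: "z \<in> generate G {e}" using zw ge e generate_singleton_trans by blast
    have "e \<in> generate G {d} \<or> d \<in> generate G {e}"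
      using C4_free_comparable[OF C4 fin e d ge(1) xyd(1) _ ze gd(2)] x z pr ne by simp
    moreover have "d \<notin> generate G {e}"
    proof
      assume "d \<in> generate G {e}"
      then have "y \<in> generate G {e}" using xyd e generate_singleton_trans by blast
      then have "q dvd p * s ^ k" using ord_dvd_of_mem_generate[OF fin e] oe y by metis
      then show False using pr ne w by (metis prime_dvd_mult_iff prime_dvd_power primes_dvd_imp_eq)
    qed
    ultimately show ?thesis using ge d generate_singleton_trans by blast
  qed
  then show ?thesis by (simp add: d_def)
qed

lemma three_primes_imp_cyclic:
  assumes C4: "C4_free (power_graph G)" and fin: "finite (carrier G)"
    and comm: "\<forall>x\<in>carrier G. \<forall>y\<in>carrier G. coprime (ord x) (ord y) \<longrightarrow> x \<otimes> y = y \<otimes> x"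
    and pr: "prime p" "prime q" "prime r" and ne: "p \<noteq> q" "p \<noteq> r" "q \<noteq> r"
    and dv: "p dvd order G" "q dvd order G" "r dvd order G"
  shows "G \<cong> integer_mod_group (p * q * r)"
proof -
  obtain x where x: "x \<in> carrier G" "ord x = p" using exists_ord_prime[OF fin pr(1) dv(1)] by blast
  obtain y where y: "y \<in> carrier G" "ord y = q" using exists_ord_prime[OF fin pr(2) dv(2)] by blast
  obtain z where z: "z \<in> carrier G" "ord z = r" using exists_ord_prime[OF fin pr(3) dv(3)] by blast
  note cc = comm[rule_format]
  have cop: "coprime p q" "coprime p r" "coprime q r" using pr ne by (auto simp: primes_coprime)
  have xy: "x \<otimes> y = y \<otimes> x" and xz: "x \<otimes> z = z \<otimes> x" and yz: "y \<otimes> z = z \<otimes> y"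
    using cc[OF x(1) y(1)] cc[OF x(1) z(1)] cc[OF y(1) z(1)] x(2) y(2) z(2) cop by metis+
  define g where "g = x \<otimes> y \<otimes> z"
  have g: "g \<in> carrier G" using x y z by (simp add: g_def)
  \<comment> \<open>Every prime \<open>s\<close> differs from at least two of \<open>p\<close>,
    \<open>q\<close>, \<open>r\<close>. The preceding lemma is applied with each of the three
    choices of that pair, which needs the same \<open>g\<close> for each order of the
    factors.\<close>
  have "x \<otimes> z \<otimes> y = g" using x y z yz by (simp add: g_def m_assoc)
  moreover have "y \<otimes> z \<otimes> x = g" using x y z xy xz by (metis g_def m_assoc)
  moreover note aux = prime_power_mem_generate_of_three_primes[OF C4 fin comm]
  ultimately have "w \<in> generate G {g}" if "w \<in> carrier G" "prime s" "ord w = s ^ k" for w s k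
    using aux[OF pr ne x y z that(1,3,2)] aux[OF pr(1,3,2) ne(2,1) ne(3)[symmetric] x z y that(1,3,2)]
      aux[OF pr(2,3,1) ne(3) ne(1,2)[symmetric] y z x that(1,3,2)] ne
    unfolding g_def by metis
  then have "generate G {g} = carrier G"
    using g by (intro subgroup_eq_carrier_of_prime_power_elements[OF fin generate_is_subgroup]) auto
  then have iso: "G \<cong> integer_mod_group (ord g)" using cyclic_iso_integer_mod_group[OF fin g] by simp
  have oxy: "ord (x \<otimes> y) = p * q"
    using ord_mult_commuting_coprime[OF fin x(1) y(1) xy] x y cop by simp
  have "ord g = p * q * r"
    unfolding g_def using ord_mult_commuting_coprime[OF fin _ z(1) cc] oxy x y z cop by simp
  then show ?thesis using iso by simp
qed

section \<open>Sufficiency of the cyclic case and of the \<open>p\<close>-group case\<close>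

lemma iso_three_primes_imp_C4_free:
  assumes fin: "finite (carrier G)"
    and pr: "prime p" "prime q" "prime r" and ne: "p \<noteq> q" "p \<noteq> r" "q \<noteq> r"
    and iso: "G \<cong> integer_mod_group (p * q * r)"
  shows "C4_free (power_graph G)"
proof -
  have "p * q * r > 1" using pr by (metis prime_gt_1_nat less_1_mult)
  then obtain g where g: "g \<in> carrier G" "carrier G = generate G {g}" "ord g = p * q * r"
    using iso iso_integer_mod_group_generator by blast
  have mem: "u \<in> generate G {v} \<longleftrightarrow> ord u dvd ord v" if "u \<in> carrier G" "v \<in> carrier G" for u v
    using that g cyclic_mem_generate_of_ord_dvd[OF fin g(1)] ord_dvd_of_mem_generate[OF fin] by blast
  have dvd: "ord u dvd p * q * r" if "u \<in> carrier G" for u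
    using that g ord_dvd_of_mem_generate[OF fin g(1)] by simp
  show ?thesis
    unfolding C4_free_power_graph_iff
    using divisors_of_three_primes_comparable[OF pr ne] by (simp add: mem dvd)
qed

lemma p_group_imp_C4_free:
  assumes fin: "finite (carrier G)" and p: "prime p" and pg: "p_group p G"
  shows "C4_free (power_graph G)"
  unfolding C4_free_power_graph_iff
proof (intro ballI impI)
  fix a b c d
  assume car: "a \<in> carrier G" "b \<in> carrier G" "c \<in> carrier G"
    and "in": "a \<in> generate G {b} \<and> a \<in> generate G {d} \<and> c \<in> generate G {b} \<and> c \<in> generate G {d}"
  obtain i j where "ord a = p ^ i" "ord c = p ^ j" using pg car unfolding p_group_def by metis
  then have "ord a dvd ord c \<or> ord c dvd ord a" using le_imp_power_dvd nat_le_linear by metis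
  then show "a \<in> generate G {c} \<or> c \<in> generate G {a} \<or> b \<in> generate G {d} \<or> d \<in> generate G {b}"
    using cyclic_mem_generate_of_ord_dvd[OF fin car(2)] "in" by blast
qed

section \<open>Orders divisible by exactly two primes\<close>

text \<open>Powers of \<open>x\<close> and \<open>x \<otimes> z\<close> with exponent divisible by
  \<open>p\<close> agree. For \<open>x\<close> of order above \<open>p\<close> the two cyclic groups
  thus share an element of order \<open>p\<close>, so \<open>chain\<close> applies and yields
  \<open>z\<close> as a power of \<open>x\<close>. With \<open>z\<close> in common, the generators
  of the Hughes subgroup form a chain, and one of maximal order generates all of them.\<close>

lemma cyclic_hughes_subgroupI:
  assumes fin: "finite (carrier G)" and p: "prime p" and pg: "p_group p G"
    and z: "z \<in> carrier G" "ord z = p" and central: "\<And>g. g \<in> carrier G \<Longrightarrow> g \<otimes> z = z \<otimes> g"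
    and chain: "\<And>u v e. u \<in> carrier G \<Longrightarrow> v \<in> carrier G \<Longrightarrow> e \<in> generate G {u} \<Longrightarrow>
      e \<in> generate G {v} \<Longrightarrow> ord e = p \<Longrightarrow> u \<in> generate G {v} \<or> v \<in> generate G {u}"
  shows "cyclic_group (hughes_subgroup p G)"
proof -
  define S where "S = {x \<in> carrier G. ord x \<noteq> p}"
  have zmem: "z \<in> generate G {x}" if x: "x \<in> S" "x \<noteq> \<one>" for x
  proof -
    have car: "x \<in> carrier G" "ord x \<noteq> p" using x by (auto simp: S_def)
    obtain k where k: "ord x = p ^ k" using pg car unfolding p_group_def by blast
    have "k \<noteq> 0" using k x(2) car ord_eq_1 by (metis power_0)
    moreover have "k \<noteq> 1" using k car by auto
    ultimately obtain j where j: "k = Suc (Suc j)" by (metis One_nat_def not0_implies_Suc)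
    have xz: "x \<otimes> z \<in> carrier G" using car z by simp
    have pow: "(x \<otimes> z) [^] n = x [^] n" if "p dvd n" for n :: nat
      using pow_mult_distrib[OF central[OF car(1)] car(1) z(1), of n] pow_eq_id[OF z(1), of n] z that car
      by simp
    have "(x \<otimes> z) [^] (p ^ k) = \<one>" using pow[of "p ^ k"] j k car by (metis dvd_triv_left pow_ord_eq_1 power_Suc)
    then have dv: "ord (x \<otimes> z) dvd ord x" using pow_eq_id[OF xz] k by simp
    \<comment> \<open>The exponent is \<open>p ^ (k - 1)\<close>: it leaves order \<open>p\<close>,
      and by \<open>k \<ge> 2\<close> it is divisible by \<open>p\<close>, so \<open>e\<close> is
      also a power of \<open>x \<otimes> z\<close>.\<close>
    define e where "e = x [^] (p ^ Suc j)"
    have "ord e = p ^ k div p ^ Suc j"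
      unfolding e_def using ord_pow[OF car(1), of "p ^ Suc j"] k j p by (simp add: prime_gt_0_nat)
    then have "ord e = p" using j p by (simp add: prime_gt_0_nat)
    moreover have "e \<in> generate G {x}" unfolding e_def using pow_mem_generate car by blast
    moreover have "e \<in> generate G {x \<otimes> z}"
      unfolding e_def using pow[of "p ^ Suc j"] pow_mem_generate[OF xz] by (metis dvd_triv_left power_Suc)
    ultimately have "x \<in> generate G {x \<otimes> z} \<or> x \<otimes> z \<in> generate G {x}"
      using chain[OF car(1) xz] by blast
    \<comment> \<open>The first alternative reduces to the second, because
      \<open>ord (x \<otimes> z)\<close> divides \<open>ord x\<close>.\<close>
    then have "x \<otimes> z \<in> generate G {x}"
      using cyclic_mem_generate_of_ord_dvd[OF fin xz generate.incl _ dv] by blast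
    then have "inv x \<otimes> (x \<otimes> z) \<in> generate G {x}"
      using mult_mem_generate[OF car(1) generate.inv[of x "{x}" G]] by simp
    then show ?thesis using car z by (simp add: inv_mult_cancel_left)
  qed
  have S: "finite S" "S \<subseteq> carrier G" using fin by (auto simp: S_def)
  \<comment> \<open>The identity has order 1, so \<open>S\<close> is nonempty and has a maximal
    order. It is the one member whose cyclic group misses \<open>z\<close>.\<close>
  have "\<one> \<in> S" using p by (auto simp: S_def)
  have cmp: "x \<in> generate G {y} \<or> y \<in> generate G {x}" if "x \<in> S" "y \<in> S" for x y
    using that S zmem chain[of x y z] z generate.one by (metis subsetD)
  have "Max (ord ` S) \<in> ord ` S" using S(1) \<open>\<one> \<in> S\<close> by (intro Max_in) auto
  then obtain m where m: "m \<in> S" "ord m = Max (ord ` S)" by (metis imageE)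
  have "x \<in> generate G {m}" if x: "x \<in> S" for x
  proof -
    have car: "x \<in> carrier G" "m \<in> carrier G" using x m S by auto
    have le: "ord x \<le> ord m" using S(1) x m(2) by simp
    have "x \<in> generate G {m}" if mx: "m \<in> generate G {x}"
    proof -
      have "ord m dvd ord x" using ord_dvd_of_mem_generate[OF fin car(1) mx] .
      then have "ord x dvd ord m" using le ord_pos[OF fin car(1)] by (metis dvd_imp_le le_antisym dvd_refl)
      then show ?thesis
        using cyclic_mem_generate_of_ord_dvd[OF fin car(1) generate.incl mx] by blast
    qed
    then show ?thesis using cmp[OF x m(1)] by blast
  qed
  then have "generate G S = generate G {m}"
    using generate_subgroup_incl[of S "generate G {m}"] generate_is_subgroup[of "{m}"] S m
      mono_generate[of "{m}" S] by blast
  moreover have "carrier G \<inter> S = S" "carrier G \<inter> {m} = {m}" using S m by auto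
  ultimately have "subgroup_generated G S = subgroup_generated G {m}" by (simp add: subgroup_generated_def)
  then show ?thesis using cyclic_group_generated by (simp add: hughes_subgroup_def S_def)
qed

text \<open>\<open>P\<close> and \<open>Q\<close> are Sylow subgroups, which commute elementwise by
  nilpotency. Assumption \<open>noq2\<close> gives \<open>Q\<close> exponent \<open>q\<close>; an
  element of order \<open>q\<close> then turns \<open>C4_free\<close> into the chain condition on
  \<open>P\<close>.\<close>

lemma two_primes_imp_product:
  assumes nil: "nilpotent_group G" and C4: "C4_free (power_graph G)" and fin: "finite (carrier G)"
    and p: "prime p" and q: "prime q" and pq: "p \<noteq> q"
    and order: "order G = p ^ a * q ^ b" and ab: "a \<noteq> 0" "b \<noteq> 0"
    and noq2: "\<And>y. y \<in> carrier G \<Longrightarrow> ord y \<noteq> q\<^sup>2"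
  shows "\<exists>P Q. internal_direct_product G P Q \<and>
    p_group p (G\<lparr>carrier := P\<rparr>) \<and> p_group q (G\<lparr>carrier := Q\<rparr>) \<and>
    cyclic_group (hughes_subgroup p (G\<lparr>carrier := P\<rparr>)) \<and>
    group_exponent (G\<lparr>carrier := Q\<rparr>) = q"
proof -
  obtain P where P: "subgroup P G" "card P = p ^ a"
    using sylow_thm[OF p is_group order fin] by blast
  have order': "order G = q ^ b * p ^ a" using order by simp
  obtain Q where Q: "subgroup Q G" "card Q = q ^ b"
    using sylow_thm[OF q is_group order' fin] by blast
  interpret P: subgroup P G by (rule P(1))
  interpret Q: subgroup Q G by (rule Q(1))
  interpret PQ: group_disjoint_sum G P Q by unfold_locales
  interpret GP: group "G\<lparr>carrier := P\<rparr>" by (rule subgroup_imp_group[OF P(1)])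
  interpret GQ: group "G\<lparr>carrier := Q\<rparr>" by (rule subgroup_imp_group[OF Q(1)])
  have finP: "finite P" and finQ: "finite Q"
    using fin P.subset Q.subset by (auto intro: finite_subset)
  have ordP: "ord x dvd p ^ a" if "x \<in> P" for x using ord_dvd_card_subgroup[OF P(1) that] P(2) by simp
  have ordQ: "ord x dvd q ^ b" if "x \<in> Q" for x using ord_dvd_card_subgroup[OF Q(1) that] Q(2) by simp
  have cop: "coprime (p ^ a) (q ^ b)" using p q pq by (simp add: primes_coprime)
  have coprimePQ: "coprime (ord x) (ord y)" if "x \<in> P" "y \<in> Q" for x y
    using coprime_divisors[OF ordP[OF that(1)] ordQ[OF that(2)] cop] .
  have comm: "x \<otimes> y = y \<otimes> x" if "x \<in> P" "y \<in> Q" for x y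
    using nilpotent_coprime_commute[OF nil _ _ coprimePQ[OF that]] that by simp
  have disj: "P \<inter> Q = {\<one>}"
  proof
    show "P \<inter> Q \<subseteq> {\<one>}"
    proof
      fix x assume x: "x \<in> P \<inter> Q"
      then have "ord x = 1" using coprimePQ[of x x] by simp
      moreover have "x \<in> carrier G" using x by simp
      ultimately show "x \<in> {\<one>}" using ord_eq_1[of x] by blast
    qed
  qed simp
  have prod: "P <#> Q = carrier G"
  \<comment> \<open>Trivial intersection makes multiplication injective on pairs, so the product set
    is as large as the group.\<close>
  proof (rule card_subset_eq[OF fin])
    show "P <#> Q \<subseteq> carrier G" by (rule set_mult_closed) (rule P.subset, rule Q.subset)
    have "P <#> Q = (\<lambda>(x, y). x \<otimes> y) ` (P \<times> Q)" by (auto simp: set_mult_def)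
    moreover have "\<forall>x\<in>P. \<forall>y\<in>Q. \<forall>x'\<in>P. \<forall>y'\<in>Q. x \<otimes> y = x' \<otimes> y' \<longrightarrow> x = x' \<and> y = y'"
      by (rule iffD1[OF PQ.cancel equalityD1[OF disj]])
    then have "inj_on (\<lambda>(x, y). x \<otimes> y) (P \<times> Q)" by (simp add: inj_on_def)
    ultimately have "card (P <#> Q) = card P * card Q"
      by (simp add: card_image card_cartesian_product)
    then show "card (P <#> Q) = card (carrier G)" using P(2) Q(2) order by (simp add: order_def)
  qed
  have normP: "P \<lhd> G" by (rule PQ.commuting_imp_normal1[OF equalityD2[OF prod] comm])
  have normQ: "Q \<lhd> G" by (rule PQ.commuting_imp_normal2[OF equalityD2[OF prod] comm])
  have idp: "internal_direct_product G P Q"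
    using normP normQ disj prod by (simp add: internal_direct_product_def)
  have pgP: "p_group p (G\<lparr>carrier := P\<rparr>)"
    unfolding p_group_def
  proof (intro conjI ballI)
    fix x assume "x \<in> carrier (G\<lparr>carrier := P\<rparr>)"
    then have "ord x dvd p ^ a" using ordP by simp
    then show "\<exists>n. GP.ord x = p ^ n"
      unfolding ord_subgroup[OF P(1)] using divides_primepow_nat[OF p] by blast
  qed (rule GP.is_group)
  have pgQ: "p_group q (G\<lparr>carrier := Q\<rparr>)"
    unfolding p_group_def
  proof (intro conjI ballI)
    fix x assume "x \<in> carrier (G\<lparr>carrier := Q\<rparr>)"
    then have "ord x dvd q ^ b" using ordQ by simp
    then show "\<exists>n. GQ.ord x = q ^ n"
      unfolding ord_subgroup[OF Q(1)] using divides_primepow_nat[OF q] by blast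
  qed (rule GQ.is_group)
  have powQ: "y [^] q = \<one>" if y: "y \<in> Q" for y
  proof -
    obtain k where k: "ord y = q ^ k" using ordQ[OF y] divides_primepow_nat[OF q] by blast
    have "\<not> k \<ge> 2"
    proof
      assume "k \<ge> 2"
      then have "q\<^sup>2 dvd ord y" using k by (simp add: le_imp_power_dvd)
      then obtain y' where "y' \<in> carrier G" "ord y' = q\<^sup>2"
        using exists_mem_generate_ord[OF fin Q.mem_carrier[OF y]] by blast
      then show False using noq2 by blast
    qed
    then have "k = 0 \<or> k = 1" by linarith
    then have "ord y dvd q" using k by auto
    then show ?thesis using pow_eq_id y by simp
  qed
  have "\<not> Q \<subseteq> {\<one>}"
  proof
    assume "Q \<subseteq> {\<one>}"
    then have "card Q \<le> card {\<one>}" by (intro card_mono) simp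
    moreover have "1 < q ^ b" using prime_gt_1_nat[OF q] ab(2) one_less_power by blast
    ultimately show False using Q(2) by simp
  qed
  then obtain y where y: "y \<in> Q" "y \<noteq> \<one>" by blast
  have yc: "y \<in> carrier G" using y by simp
  have "ord y dvd q" using powQ y pow_eq_id by simp
  moreover have "ord y \<noteq> 1" using y ord_eq_1[OF yc] by simp
  ultimately have oy: "ord y = q" using q by (metis prime_nat_iff)
  have expQ: "group_exponent (G\<lparr>carrier := Q\<rparr>) = q"
  proof (rule GQ.group_exponent_eq_prime[OF q])
    fix x assume "x \<in> carrier (G\<lparr>carrier := Q\<rparr>)"
    then show "x [^]\<^bsub>G\<lparr>carrier := Q\<rparr>\<^esub> q = \<one>\<^bsub>G\<lparr>carrier := Q\<rparr>\<^esub>"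
      using powQ[of x] nat_pow_consistent[of x q Q] by simp
  qed (use y in auto)
  \<comment> \<open>Multiplying \<open>u\<close> and \<open>v\<close> by \<open>y\<close> adds a
    shared element of the second prime order \<open>q\<close>, so the products are comparable. As
    \<open>q\<close> is coprime to the orders of \<open>u\<close> and \<open>v\<close>, it can be
    cancelled again.\<close>
  have chain: "u \<in> generate G {v} \<or> v \<in> generate G {u}"
    if u: "u \<in> P" and v: "v \<in> P" and e: "e \<in> generate G {u}" "e \<in> generate G {v}" "ord e = p" for u v e
  proof -
    have car: "u \<in> carrier G" "v \<in> carrier G" using u v by auto
    have uy: "u \<in> generate G {u \<otimes> y}" "y \<in> generate G {u \<otimes> y}" "ord (u \<otimes> y) = ord u * q"
      using commuting_coprime_mem_generate[OF fin car(1) yc comm[OF u y(1)] coprimePQ[OF u y(1)]]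
        ord_mult_commuting_coprime[OF fin car(1) yc comm[OF u y(1)] coprimePQ[OF u y(1)]] oy by simp_all
    have vy: "v \<in> generate G {v \<otimes> y}" "y \<in> generate G {v \<otimes> y}" "ord (v \<otimes> y) = ord v * q"
      using commuting_coprime_mem_generate[OF fin car(2) yc comm[OF v y(1)] coprimePQ[OF v y(1)]]
        ord_mult_commuting_coprime[OF fin car(2) yc comm[OF v y(1)] coprimePQ[OF v y(1)]] oy by simp_all
    have cy: "u \<otimes> y \<in> carrier G" "v \<otimes> y \<in> carrier G" using car yc by auto
    have copq: "coprime (ord u) q" "coprime (ord v) q"
      using coprimePQ[OF u y(1)] coprimePQ[OF v y(1)] oy by simp_all
    have "e \<in> generate G {u \<otimes> y}" "e \<in> generate G {v \<otimes> y}"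
      using generate_singleton_trans e uy(1) vy(1) cy by blast+
    then have "u \<otimes> y \<in> generate G {v \<otimes> y} \<or> v \<otimes> y \<in> generate G {u \<otimes> y}"
      using C4_free_comparable[OF C4 fin cy _ _ _ uy(2) vy(2)] e(3) p q pq oy by simp
    then show ?thesis
    proof
      assume "u \<otimes> y \<in> generate G {v \<otimes> y}"
      then have uvy: "u \<in> generate G {v \<otimes> y}" using uy cy generate_singleton_trans by blast
      then have "ord u dvd ord v * q" using ord_dvd_of_mem_generate[OF fin cy(2)] vy(3) by metis
      then have "ord u dvd ord v" using copq coprime_dvd_mult_left_iff by blast
      then show ?thesis using cyclic_mem_generate_of_ord_dvd[OF fin cy(2) uvy vy(1)] by blast
    next
      assume "v \<otimes> y \<in> generate G {u \<otimes> y}"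
      then have vuy: "v \<in> generate G {u \<otimes> y}" using vy cy generate_singleton_trans by blast
      then have "ord v dvd ord u * q" using ord_dvd_of_mem_generate[OF fin cy(1)] uy(3) by metis
      then have "ord v dvd ord u" using copq coprime_dvd_mult_left_iff by blast
      then show ?thesis using cyclic_mem_generate_of_ord_dvd[OF fin cy(1) vuy uy(1)] by blast
    qed
  qed
  have "1 < p ^ a" using prime_gt_1_nat[OF p] ab(1) one_less_power by blast
  then have "P \<noteq> {\<one>}" using P(2) by fastforce
  \<comment> \<open>A central element of order \<open>p\<close> is a suitable power of any
    nontrivial central element of \<open>P\<close>.\<close>
  then obtain w where w: "w \<in> P" "w \<noteq> \<one>" "\<And>g. g \<in> carrier G \<Longrightarrow> g \<otimes> w = w \<otimes> g"
    using nilpotent_normal_inter_center[OF nil normP] by blast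
  have wc: "w \<in> carrier G" using w by simp
  obtain k where k: "ord w = p ^ k" using ordP[OF w(1)] divides_primepow_nat[OF p] by blast
  have "k \<noteq> 0" using k w(2) wc ord_eq_1 by (metis power_0)
  then have "p dvd ord w" using k by simp
  define z where "z = w [^] (ord w div p)"
  have z: "z \<in> P" "ord z = p"
    using ord_pow_div[OF fin wc \<open>p dvd ord w\<close>] w(1) GP.nat_pow_closed[of w "ord w div p"]
      nat_pow_consistent[of w "ord w div p" P] by (simp_all add: z_def)
  have central: "g \<otimes> z = z \<otimes> g" if g: "g \<in> carrier G" for g
    unfolding z_def using group_commutes_pow[of w g "ord w div p"] w(3)[OF g] wc g by simp
  have gen: "generate (G\<lparr>carrier := P\<rparr>) {u} = generate G {u}" if "u \<in> P" for u
    using generate_consistent[OF _ P(1), of "{u}"] that by simp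
  have "cyclic_group (hughes_subgroup p (G\<lparr>carrier := P\<rparr>))"
  proof (rule GP.cyclic_hughes_subgroupI[OF _ p pgP])
    fix u v e
    assume "u \<in> carrier (G\<lparr>carrier := P\<rparr>)" "v \<in> carrier (G\<lparr>carrier := P\<rparr>)"
      "e \<in> generate (G\<lparr>carrier := P\<rparr>) {u}" "e \<in> generate (G\<lparr>carrier := P\<rparr>) {v}" "GP.ord e = p"
    then show "u \<in> generate (G\<lparr>carrier := P\<rparr>) {v} \<or> v \<in> generate (G\<lparr>carrier := P\<rparr>) {u}"
      using chain[of u v e] by (simp add: gen ord_subgroup[OF P(1)])
  next
    fix g assume "g \<in> carrier (G\<lparr>carrier := P\<rparr>)"
    then show "g \<otimes>\<^bsub>G\<lparr>carrier := P\<rparr>\<^esub> z = z \<otimes>\<^bsub>G\<lparr>carrier := P\<rparr>\<^esub> g" using central[of g] by simp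
  qed (use finP z in \<open>simp_all add: ord_subgroup[OF P(1)]\<close>)
  then show ?thesis using idp pgP pgQ expQ by blast
qed

text \<open>Elements of orders \<open>p * q\<^sup>2\<close> and \<open>p\<^sup>2 * q\<close> can be
  built that share elements of orders \<open>p\<close> and \<open>q\<close>. Neither order divides
  the other, so they are not comparable.\<close>

lemma mixed_square_orders_imp_not_C4_free:
  assumes nil: "nilpotent_group G" and fin: "finite (carrier G)"
    and p: "prime p" and q: "prime q" and pq: "p \<noteq> q"
    and x: "x \<in> carrier G" "ord x = p\<^sup>2" and y: "y \<in> carrier G" "ord y = q\<^sup>2"
  shows "\<not> C4_free (power_graph G)"
proof
  assume C4: "C4_free (power_graph G)"
  have cop: "coprime p q" using p q pq by (simp add: primes_coprime)
  obtain x' where x': "x' \<in> carrier G" "x' \<in> generate G {x}" "ord x' = p"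
    using exists_mem_generate_ord[OF fin x(1), of p] x(2) by (auto simp: power2_eq_square)
  obtain y' where y': "y' \<in> carrier G" "y' \<in> generate G {y}" "ord y' = q"
    using exists_mem_generate_ord[OF fin y(1), of q] y(2) by (auto simp: power2_eq_square)
  have c1: "coprime (ord x') (ord y)" and c2: "coprime (ord x) (ord y')" using x y x' y' cop by simp_all
  define b d where "b = x' \<otimes> y" and "d = x \<otimes> y'"
  have b: "b \<in> carrier G" and d: "d \<in> carrier G" using x y x' y' by (simp_all add: b_def d_def)
  have gb: "x' \<in> generate G {b}" "y \<in> generate G {b}" "ord b = p * q\<^sup>2"
    using commuting_coprime_mem_generate[OF fin x'(1) y(1) nilpotent_coprime_commute[OF nil x'(1) y(1) c1] c1]
      ord_mult_commuting_coprime[OF fin x'(1) y(1) nilpotent_coprime_commute[OF nil x'(1) y(1) c1] c1]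
      x' y by (simp_all add: b_def)
  have gd: "x \<in> generate G {d}" "y' \<in> generate G {d}" "ord d = p\<^sup>2 * q"
    using commuting_coprime_mem_generate[OF fin x(1) y'(1) nilpotent_coprime_commute[OF nil x(1) y'(1) c2] c2]
      ord_mult_commuting_coprime[OF fin x(1) y'(1) nilpotent_coprime_commute[OF nil x(1) y'(1) c2] c2]
      x y' by (simp_all add: d_def)
  have "x' \<in> generate G {d}" "y' \<in> generate G {b}"
    using x' y' gb gd b d generate_singleton_trans by blast+
  then have "b \<in> generate G {d} \<or> d \<in> generate G {b}"
    using C4_free_comparable[OF C4 fin b d gb(1) _ _ _ gd(2)] x' y' p q pq by simp
  then have "p * q\<^sup>2 dvd p\<^sup>2 * q \<or> p\<^sup>2 * q dvd p * q\<^sup>2"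
    using ord_dvd_of_mem_generate[OF fin] b d gb gd by metis
  then have "q dvd p \<or> p dvd q"
    using p q by (auto simp: power2_eq_square prime_gt_0_nat)
  then show False using p q pq primes_dvd_imp_eq by blast
qed

section \<open>Sufficiency of the direct product case\<close>

text \<open>Orders have the form \<open>p ^ i\<close> or \<open>p ^ i * q\<close>. If
  \<open>a\<close> and \<open>c\<close> are not comparable, then elements with orders divisible by
  \<open>p\<close> and by \<open>q\<close> lie in both outer groups. These have the same
  \<open>Q\<close>-component up to generators, and the cyclic Hughes subgroup compares their
  \<open>P\<close>-components.\<close>

lemma product_imp_C4_free:
  assumes fin: "finite (carrier G)" and p: "prime p" and q: "prime q" and pq: "p \<noteq> q"
    and idp: "internal_direct_product G P Q"
    and pgP: "p_group p (G\<lparr>carrier := P\<rparr>)"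
    and cyc: "cyclic_group (hughes_subgroup p (G\<lparr>carrier := P\<rparr>))"
    and expQ: "group_exponent (G\<lparr>carrier := Q\<rparr>) = q"
  shows "C4_free (power_graph G)"
proof -
  have normP: "P \<lhd> G" and normQ: "Q \<lhd> G" and disj: "P \<inter> Q = {\<one>}" and prod: "P <#> Q = carrier G"
    using idp by (auto simp: internal_direct_product_def)
  have P: "subgroup P G" and Q: "subgroup Q G" using normP normQ normal_imp_subgroup by auto
  interpret P: subgroup P G by (rule P)
  interpret Q: subgroup Q G by (rule Q)
  interpret GP: group "G\<lparr>carrier := P\<rparr>" by (rule subgroup_imp_group[OF P])
  interpret GQ: group "G\<lparr>carrier := Q\<rparr>" by (rule subgroup_imp_group[OF Q])
  have finQ: "finite Q" using fin Q.subset by (auto intro: finite_subset)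
  have comm: "x \<otimes> y = y \<otimes> x" if "x \<in> P" "y \<in> Q" for x y
    using normal_imp_commuting[OF normP normQ _ that] disj by simp
  have ordP: "\<exists>k. ord x = p ^ k" if "x \<in> P" for x
    using pgP that unfolding p_group_def by (simp add: ord_subgroup[OF P])
  have ordQ: "ord y dvd q" if y: "y \<in> Q" for y
  proof -
    have "y [^]\<^bsub>G\<lparr>carrier := Q\<rparr>\<^esub> group_exponent (G\<lparr>carrier := Q\<rparr>) = \<one>\<^bsub>G\<lparr>carrier := Q\<rparr>\<^esub>"
      using finQ y by (intro GQ.pow_group_exponent) simp_all
    then have "y [^] q = \<one>" using expQ nat_pow_consistent[of y q Q] by simp
    then show ?thesis using pow_eq_id y by simp
  qed
  have decomp: "\<exists>u\<in>P. \<exists>v\<in>Q. \<exists>i. g = u \<otimes> v \<and> u \<in> generate G {g} \<and> v \<in> generate G {g} \<and>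
      ord u = p ^ i \<and> ord v dvd q \<and> ord g = p ^ i * ord v" if g: "g \<in> carrier G" for g
  proof -
    have "g \<in> P <#> Q" using g prod by simp
    then obtain u v where uv: "u \<in> P" "v \<in> Q" "g = u \<otimes> v" unfolding set_mult_def by blast
    obtain i where i: "ord u = p ^ i" using ordP uv by blast
    have car: "u \<in> carrier G" "v \<in> carrier G" using uv by auto
    have "coprime (p ^ i) q" using p q pq by (simp add: primes_coprime)
    then have cop: "coprime (ord u) (ord v)"
      unfolding i using coprime_divisors[OF dvd_refl ordQ[OF uv(2)]] by blast
    have "ord g = p ^ i * ord v"
      using ord_mult_commuting_coprime[OF fin car comm[OF uv(1,2)] cop] i uv(3) by simp
    moreover have "u \<in> generate G {g}" "v \<in> generate G {g}"
      using commuting_coprime_mem_generate[OF fin car comm[OF uv(1,2)] cop] uv(3) by simp_all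
    ultimately show ?thesis using uv i ordQ[OF uv(2)] by blast
  qed
  obtain m where m: "m \<in> carrier (hughes_subgroup p (G\<lparr>carrier := P\<rparr>))"
      "subgroup_generated (hughes_subgroup p (G\<lparr>carrier := P\<rparr>)) {m} = hughes_subgroup p (G\<lparr>carrier := P\<rparr>)"
    using cyc unfolding cyclic_group_def by blast
  define S where "S = {x \<in> P. ord x \<noteq> p}"
  define H where "H = generate G S"
  have SP: "S \<subseteq> P" by (auto simp: S_def)
  \<comment> \<open>The Hughes subgroup is formed inside \<open>P\<close>; rewriting it as a
    subgroup of \<open>G\<close> lets its generator \<open>m\<close> be used with
    \<open>generate G\<close>.\<close>
  have hugh: "hughes_subgroup p (G\<lparr>carrier := P\<rparr>) = G\<lparr>carrier := H\<rparr>"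
  proof -
    have "P \<inter> {x \<in> P. ord x \<noteq> p} = S" by (auto simp: S_def)
    then show ?thesis
      using generate_consistent[OF SP P]
      by (simp add: hughes_subgroup_def subgroup_generated_def ord_subgroup[OF P] H_def)
  qed
  have H: "subgroup H G" unfolding H_def using SP P.subset by (intro generate_is_subgroup) auto
  have carH: "carrier (G\<lparr>carrier := H\<rparr>) = H" by simp
  have mH: "m \<in> H" using m(1) unfolding hugh carH .
  have mc: "m \<in> carrier G" by (rule subgroup.mem_carrier[OF H mH])
  have "H = generate G {m}"
  proof -
    have "generate (G\<lparr>carrier := H\<rparr>) (H \<inter> {m}) = H"
      using arg_cong[OF m(2)[unfolded hugh], of carrier] unfolding carrier_subgroup_generated carH .
    moreover have "H \<inter> {m} = {m}" using mH by blast
    moreover have "generate (G\<lparr>carrier := H\<rparr>) {m} = generate G {m}"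
      using mH by (intro generate_consistent[OF _ H]) blast
    ultimately show ?thesis by simp
  qed
  then have big: "x \<in> generate G {m}" if "x \<in> P" "ord x \<noteq> p" for x
    using generate.incl[of x S G] that unfolding H_def[symmetric] by (simp add: S_def)
  have chain: "u \<in> generate G {v} \<or> v \<in> generate G {u}"
    if u: "u \<in> P" and v: "v \<in> P" and e: "e \<in> generate G {u}" "e \<in> generate G {v}" "ord e = p" for u v e
  proof -
    have car: "u \<in> carrier G" "v \<in> carrier G" using u v by auto
    \<comment> \<open>An element of order \<open>p\<close> generates the same subgroup as
      \<open>e\<close> and so lies in the other cyclic group. Otherwise both elements are powers of
      \<open>m\<close>.\<close>
    consider "ord u = p" | "ord v = p" | "ord u \<noteq> p" "ord v \<noteq> p" by blast
    then show ?thesis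
    proof cases
      case 1
      then have "u \<in> generate G {e}"
        using cyclic_mem_generate_of_ord_dvd[OF fin car(1) generate.incl e(1)] e by simp
      then show ?thesis using e car generate_singleton_trans by blast
    next
      case 2
      then have "v \<in> generate G {e}"
        using cyclic_mem_generate_of_ord_dvd[OF fin car(2) generate.incl e(2)] e by simp
      then show ?thesis using e car generate_singleton_trans by blast
    next
      case 3
      have um: "u \<in> generate G {m}" and vm: "v \<in> generate G {m}" using big u v 3 by simp_all
      obtain i where i: "ord u = p ^ i" using ordP[OF u] by blast
      obtain j where j: "ord v = p ^ j" using ordP[OF v] by blast
      have "ord u dvd ord v \<or> ord v dvd ord u"
        unfolding i j using le_imp_power_dvd[of i j p] le_imp_power_dvd[of j i p] nat_le_linear[of i j] by blast
      then show ?thesis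
        using cyclic_mem_generate_of_ord_dvd[OF fin mc um vm] cyclic_mem_generate_of_ord_dvd[OF fin mc vm um]
        by blast
    qed
  qed
  have key: "b \<in> generate G {d} \<or> d \<in> generate G {b}"
    if b: "b \<in> carrier G" and d: "d \<in> carrier G"
      and s: "s \<in> generate G {b}" "s \<in> generate G {d}" "p dvd ord s"
      and t: "t \<in> generate G {b}" "t \<in> generate G {d}" "q dvd ord t" for b d s t
  proof -
    have sc: "s \<in> carrier G" and tc: "t \<in> carrier G" using s t b generate_singleton_closed by auto
    obtain e where e: "e \<in> generate G {s}" "ord e = p" using exists_mem_generate_ord[OF fin sc s(3)] by blast
    obtain y where y: "y \<in> generate G {t}" "ord y = q" using exists_mem_generate_ord[OF fin tc t(3)] by blast
    \<comment> \<open>The \<open>Q\<close>-component of \<open>g\<close> has order exactly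
      \<open>q\<close>, so it generates the same subgroup as \<open>y\<close>, whichever
      \<open>g\<close> is taken. Only the \<open>P\<close>-components of \<open>b\<close> and
      \<open>d\<close> remain to be compared.\<close>
    have part: "\<exists>u\<in>P. \<exists>v. g = u \<otimes> v \<and> u \<in> generate G {g} \<and> e \<in> generate G {u} \<and>
        v \<in> generate G {y} \<and> y \<in> generate G {v}"
      if g: "g \<in> carrier G" and sg: "s \<in> generate G {g}" and tg: "t \<in> generate G {g}" for g
    proof -
      have eg: "e \<in> generate G {g}" and yg: "y \<in> generate G {g}"
        using e y sg tg g generate_singleton_trans by blast+
      obtain u v i where uv: "u \<in> P" "v \<in> Q" "g = u \<otimes> v" "u \<in> generate G {g}" "v \<in> generate G {g}"
          "ord u = p ^ i" "ord v dvd q" "ord g = p ^ i * ord v" using decomp[OF g] by blast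
      have pdv: "p dvd p ^ i * ord v" and qdv: "q dvd p ^ i * ord v"
        using ord_dvd_of_mem_generate[OF fin g eg] ord_dvd_of_mem_generate[OF fin g yg] e y uv by simp_all
      have "\<not> p dvd q" "\<not> q dvd p" using p q pq primes_dvd_imp_eq by blast+
      then have "\<not> p dvd ord v" "\<not> q dvd p ^ i" using uv(7) dvd_trans prime_dvd_power[OF q] by blast+
      then have "p dvd p ^ i" "q dvd ord v" using pdv qdv p q prime_dvd_mult_iff by blast+
      then have "ord e dvd ord u" "ord v = ord y" using uv(6,7) e(2) y(2) dvd_antisym by auto
      then have "v \<in> generate G {y}" "y \<in> generate G {v}" "e \<in> generate G {u}"
        using cyclic_mem_generate_of_ord_dvd[OF fin g uv(5) yg] cyclic_mem_generate_of_ord_dvd[OF fin g yg uv(5)]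
          cyclic_mem_generate_of_ord_dvd[OF fin g eg uv(4)] by simp_all
      then show ?thesis using uv by blast
    qed
    obtain u v where uv: "u \<in> P" "b = u \<otimes> v" "u \<in> generate G {b}" "e \<in> generate G {u}"
        "v \<in> generate G {y}" "y \<in> generate G {v}" using part[OF b s(1) t(1)] by blast
    obtain u' v' where uv': "u' \<in> P" "d = u' \<otimes> v'" "u' \<in> generate G {d}" "e \<in> generate G {u'}"
        "v' \<in> generate G {y}" "y \<in> generate G {v'}" using part[OF d s(2) t(2)] by blast
    have yb: "y \<in> generate G {b}" "y \<in> generate G {d}" using y t b d generate_singleton_trans by blast+
    have vb: "v' \<in> generate G {b}" "v \<in> generate G {d}"
      using uv(5) uv'(5) yb b d generate_singleton_trans by blast+
    show ?thesis
      using chain[OF uv(1) uv'(1) uv(4) uv'(4) e(2)]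
    proof
      assume "u \<in> generate G {u'}"
      then have "u \<in> generate G {d}" using uv' d generate_singleton_trans by blast
      then show ?thesis using mult_mem_generate[OF d _ vb(2)] uv(2) by simp
    next
      assume "u' \<in> generate G {u}"
      then have "u' \<in> generate G {b}" using uv b generate_singleton_trans by blast
      then show ?thesis using mult_mem_generate[OF b _ vb(1)] uv'(2) by simp
    qed
  qed
  have half: "b \<in> generate G {d} \<or> d \<in> generate G {b}"
    if b: "b \<in> carrier G" and d: "d \<in> carrier G" and ac: "a \<in> generate G {b}" "a \<in> generate G {d}"
      "c \<in> generate G {b}" "c \<in> generate G {d}" and n: "c \<notin> generate G {a}"
      and orda: "ord a = p ^ i * q" and ordc: "ord c = p ^ j" for a b c d i j
  proof -
    \<comment> \<open>Otherwise \<open>c\<close> would be the identity, which lies in every cyclic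
      subgroup.\<close>
    have "j \<noteq> 0"
    proof
      assume "j = 0"
      then have "c = \<one>" using ordc ord_eq_1 b ac generate_singleton_closed by (metis power_0)
      then show False using n generate.one by metis
    qed
    then have "p dvd ord c" "q dvd ord a" using orda ordc by simp_all
    then show ?thesis using key[OF b d ac(3,4) _ ac(1,2)] by blast
  qed
  show ?thesis
    unfolding C4_free_power_graph_iff
  proof (intro ballI impI)
    fix a b c d
    assume car: "a \<in> carrier G" "b \<in> carrier G" "c \<in> carrier G" "d \<in> carrier G"
      and "a \<in> generate G {b} \<and> a \<in> generate G {d} \<and> c \<in> generate G {b} \<and> c \<in> generate G {d}"
    then have ac: "a \<in> generate G {b}" "a \<in> generate G {d}" "c \<in> generate G {b}" "c \<in> generate G {d}"
      by blast+
    have form: "\<exists>i f. ord g = p ^ i * f \<and> (f = 1 \<or> f = q)" if g: "g \<in> carrier G" for g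
    proof -
      obtain v i where "ord g = p ^ i * ord v" "ord v dvd q" using decomp[OF g] by blast
      then show ?thesis using q unfolding prime_nat_iff by blast
    qed
    obtain i f where a: "ord a = p ^ i * f" "f = 1 \<or> f = q" using form[OF car(1)] by blast
    obtain j h where c: "ord c = p ^ j * h" "h = 1 \<or> h = q" using form[OF car(3)] by blast
    \<comment> \<open>For \<open>f = h\<close> the orders of \<open>a\<close> and \<open>c\<close>
      are comparable. Otherwise exactly one of them involves \<open>q\<close>, and
      \<open>half\<close> applies, in the last case with \<open>a\<close> and \<open>c\<close>
      exchanged.\<close>
    consider "f = h" | "f = q" "h = 1" | "f = 1" "h = q" using a c by blast
    then show "a \<in> generate G {c} \<or> c \<in> generate G {a} \<or> b \<in> generate G {d} \<or> d \<in> generate G {b}"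
    proof cases
      case 1
      have "p ^ i dvd p ^ j \<or> p ^ j dvd p ^ i"
        using le_imp_power_dvd[of i j p] le_imp_power_dvd[of j i p] nat_le_linear[of i j] by blast
      then have "ord a dvd ord c \<or> ord c dvd ord a"
        unfolding a(1) c(1) \<open>f = h\<close> by (meson mult_dvd_mono dvd_refl)
      then show ?thesis using cyclic_mem_generate_of_ord_dvd[OF fin car(2)] ac by blast
    next
      case 2
      then have "c \<notin> generate G {a} \<Longrightarrow> ?thesis" using half[OF car(2,4) ac, of i j] a(1) c(1) by simp
      then show ?thesis by blast
    next
      case 3
      then have "a \<notin> generate G {c} \<Longrightarrow> ?thesis"
        using half[OF car(2,4) ac(3,4,1,2), of j i] a(1) c(1) by simp
      then show ?thesis by blast
    qed
  qed
qed

end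

theorem theorem3p5:
  fixes G :: "('a, 'b) monoid_scheme"
  assumes "group G" and "finite (carrier G)" and "nilpotent_group G"
  shows "C4_free (power_graph G) \<longleftrightarrow>
    (\<exists>p q r :: nat. prime p \<and> prime q \<and> prime r \<and> p \<noteq> q \<and> p \<noteq> r \<and> q \<noteq> r \<and>
       (G \<cong> integer_mod_group (p * q * r) \<or>
        (\<exists>P Q. internal_direct_product G P Q \<and>
               p_group p (G\<lparr>carrier := P\<rparr>) \<and> p_group q (G\<lparr>carrier := Q\<rparr>) \<and>
               cyclic_group (hughes_subgroup p (G\<lparr>carrier := P\<rparr>)) \<and>
               group_exponent (G\<lparr>carrier := Q\<rparr>) = q) \<or>
        p_group p G))"
    (is "_ \<longleftrightarrow> ?rhs")
proof -
  interpret group G by (rule assms(1))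
  note fin = assms(2) and nil = assms(3)
  let ?prod = "\<lambda>p q. \<exists>P Q. internal_direct_product G P Q \<and>
               p_group p (G\<lparr>carrier := P\<rparr>) \<and> p_group q (G\<lparr>carrier := Q\<rparr>) \<and>
               cyclic_group (hughes_subgroup p (G\<lparr>carrier := P\<rparr>)) \<and>
               group_exponent (G\<lparr>carrier := Q\<rparr>) = q"
  let ?distinct = "\<lambda>p q r::nat. prime p \<and> prime q \<and> prime r \<and> p \<noteq> q \<and> p \<noteq> r \<and> q \<noteq> r"
  \<comment> \<open>The abbreviation \<open>?distinct\<close> brackets the conjunction differently
    from the statement.\<close>
  have rhs: "?rhs \<longleftrightarrow>
      (\<exists>p q r. ?distinct p q r \<and> (G \<cong> integer_mod_group (p * q * r) \<or> ?prod p q \<or> p_group p G))"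
    by (simp only: conj_assoc)
  \<comment> \<open>The statement always asks for three distinct primes, so spare ones are supplied
    when the group order has fewer prime divisors.\<close>
  have other: "\<exists>r::nat. prime r \<and> r \<noteq> p \<and> r \<noteq> q" for p q
    using bigger_prime[of "max p q"] by (metis max_less_iff_conj less_irrefl)
  have order0: "order G \<noteq> 0" using fin order_gt_0_iff_finite by simp
  show ?thesis
    unfolding rhs
  proof
    assume C4: "C4_free (power_graph G)"
    have comm: "\<forall>x\<in>carrier G. \<forall>y\<in>carrier G. coprime (ord x) (ord y) \<longrightarrow> x \<otimes>\<^bsub>G\<^esub> y = y \<otimes>\<^bsub>G\<^esub> x"
      using nilpotent_coprime_commute[OF nil] by blast
    \<comment> \<open>The split is by the number of primes dividing the group order. The trivial
      group falls under \<open>one\<close>, with 2 as a possible \<open>p\<close>.\<close>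
    consider (three) p q r where "prime p" "prime q" "prime r" "p \<noteq> q" "p \<noteq> r" "q \<noteq> r"
        "p dvd order G" "q dvd order G" "r dvd order G"
      | (two) p q where "prime p" "prime q" "p \<noteq> q" "p dvd order G" "q dvd order G"
        "\<And>s. prime s \<Longrightarrow> s dvd order G \<Longrightarrow> s = p \<or> s = q"
      | (one) p where "prime p" "\<And>s. prime s \<Longrightarrow> s dvd order G \<Longrightarrow> s = p"
      by (metis two_is_prime_nat)
    then show "\<exists>p q r. ?distinct p q r \<and> (G \<cong> integer_mod_group (p * q * r) \<or> ?prod p q \<or> p_group p G)"
    proof cases
      case three
      then show ?thesis using three_primes_imp_cyclic[OF C4 fin comm] by blast
    next
      case two
      obtain m where m: "order G = p ^ multiplicity p (order G) * m" "\<not> p dvd m"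
        using multiplicity_decompose'[of "order G" p] order0 two(1) not_prime_unit by metis
      have "m \<noteq> 0" using m(2) by (metis dvd_0_right)
      moreover have "s = q" if "prime s" "s dvd m" for s
      proof -
        have "s dvd order G" using that m(1) by (metis dvd_mult)
        then show ?thesis using two(6) that m(2) by blast
      qed
      ultimately obtain k where k: "m = q ^ k" using eq_prime_power_of_only_prime two(2) by blast
      define a where "a = multiplicity p (order G)"
      have order: "order G = p ^ a * q ^ k" using m(1) k by (simp add: a_def)
      have "a \<noteq> 0" using two(1,4) order0 prime_multiplicity_gt_zero_iff[of p "order G"] by (simp add: a_def)
      moreover have "k \<noteq> 0"
      proof
        assume "k = 0"
        then have "q dvd p ^ a" using two(5) order by simp
        then show False using two(1-3) by (metis prime_dvd_power primes_dvd_imp_eq)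
      qed
      \<comment> \<open>It is not known in advance which prime lacks elements of squared order; in
        the second case \<open>p\<close> and \<open>q\<close> change roles in the product.\<close>
      moreover have "(\<forall>y\<in>carrier G. ord y \<noteq> q\<^sup>2) \<or> (\<forall>x\<in>carrier G. ord x \<noteq> p\<^sup>2)"
        using mixed_square_orders_imp_not_C4_free[OF nil fin two(1-3)] C4 by blast
      moreover have "order G = q ^ k * p ^ a" using order by simp
      ultimately have "?prod p q \<or> ?prod q p"
        using two_primes_imp_product[OF nil C4 fin two(1-3) order]
          two_primes_imp_product[OF nil C4 fin two(2,1) two(3)[symmetric]] by metis
      moreover obtain r where "prime r" "r \<noteq> p" "r \<noteq> q" using other by blast
      ultimately show ?thesis using two(1-3) by metis
    next
      case one
      obtain k where k: "order G = p ^ k" using eq_prime_power_of_only_prime[OF order0 one] by blast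
      have "p_group p G"
        unfolding p_group_def using assms(1) ord_dvd_group_order k divides_primepow_nat[OF one(1)] by metis
      moreover obtain q where "prime q" "q \<noteq> p" using other by blast
      moreover from other obtain r where "prime r" "r \<noteq> p" "r \<noteq> q" by blast
      ultimately show ?thesis using one(1) by metis
    qed
  next
    assume "\<exists>p q r. ?distinct p q r \<and> (G \<cong> integer_mod_group (p * q * r) \<or> ?prod p q \<or> p_group p G)"
    then obtain p q r where d: "?distinct p q r"
      and "G \<cong> integer_mod_group (p * q * r) \<or> ?prod p q \<or> p_group p G" by blast
    then show "C4_free (power_graph G)"
      using iso_three_primes_imp_C4_free[OF fin] product_imp_C4_free[OF fin] p_group_imp_C4_free[OF fin]
      by blast
  qed
qed

end
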